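(* Let $f:\mathbb{R}^d\to\mathbb{R}\cup\{\infty\}$ be $\ell$-smooth, suppose there is $f^*\in\mathbb{R}$ with $f(x)\ge f^*$ for all $x\in\mathcal{X}$, and let $\nabla f(x;\xi)$ be stochastic gradients satisfying, for some $\sigma>0$ and all $x\in\mathcal{X}$, $\mathbb{E}_\xi[\nabla f(x;\xi)]=\nabla f(x)$ and $\mathbb{E}_\xi[\exp(\|\nabla f(x;\xi)-\nabla f(x)\|^2/\sigma^2)]\le\exp(1)$. Let $x_0\in\mathcal{X}$, $\Delta:=f(x_0)-f^*$, $r:=\sup_{s\ge0}[\ell(2s)/\ell(s)]$, $\varepsilon>0$ and $\delta\in(0,1)$. Let $T$ denote the number (of iterations) required to ensure that $\min_{k\in\{0,\dots,T-1\}}\|\nabla f(x_k)\|^2\le\varepsilon$ based on the inequality $$\min_{k\in\{0,\dots,T-1\}}\frac{\left(\frac32\|\nabla f(x_k)\|\right)^2}{\ell(3\|\nabla f(x_k)\|)}\le r\times\frac{45\Delta}{T},$$ that is, $T$ is such that, for the iterates $x_0,\dots,x_{T-1}$ of the method described in the context, validity of this inequality implies $\min_{k\in\{0,\dots,T-1\}}\|\nabla f(x_k)\|^2\le\varepsilon$. Then, with probability at least $1-\delta$ and with batch size $$B=\max\left\{\left\lceil\frac{32\left(1+\sqrt{3\log(T/\delta)}\right)^2\sigma^2}{\varepsilon}\right\rceil,1\right\},$$ the stochastic gradient method (SGD) described in the context finds an $\varepsilon$-stationary point after $T$ iterations, i.e. there is $k\in\{0,\dots,T-1\}$ with $\|\nabla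 f(x_k)\|^2\le\varepsilon$, and the total number of computed stochastic gradients is $B\times T$.
   Context: Norms are Euclidean for vectors and spectral for matrices. For $f:\mathbb{R}^d\to\mathbb{R}\cup\{\infty\}$ put $\mathcal{X}=\{x\in\mathbb{R}^d: f(x)<\infty\}$, assumed to be open and convex. $f$ is $\ell$-smooth if $f$ is twice differentiable on $\mathcal{X}$, $f$ is continuous on the closure of $\mathcal{X}$ (as a map into $\mathbb{R}\cup\{\infty\}$), and $\ell:[0,\infty)\to(0,\infty)$ is a non-decreasing positive locally Lipschitz function such that $\|\nabla^2f(x)\|\le\ell(\|\nabla f(x)\|)$ for all $x\in\mathcal{X}$. A point $\bar x$ is $\varepsilon$-stationary if $\|\nabla f(\bar x)\|^2\le\varepsilon$. SGD with batch size $B$: starting from $x_0\in\mathcal{X}$, for $k=0,1,\dots$ compute $$g_k=\frac1B\sum_{j=1}^B\nabla f(x_k;\xi_{kj}),\qquad \gamma_k=\frac1{5r}\int_0^1\frac{dv}{\ell(\|g_k\|+\|g_k\|v)},\qquad x_{k+1}=x_k-\gamma_kg_k,$$ where the $\{\xi_{kj}\}$ are i.i.d. copies of $\xi$ and $r=\sup_{s\ge0}[\ell(2s)/\ell(s)]$, which is taken to be finite so that the step size is defined. *)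

theory Defs
  imports "HOL-Probability.Probability"
begin

text \<open>
  Functions \<open>f : \<real>\<^sup>d \<rightarrow> \<real> \<union> {\<infinity>}\<close> have type \<open>'a::euclidean_space \<Rightarrow> ereal\<close>; that the value
  \<open>-\<infinity>\<close> is not taken is a hypothesis wherever it matters.
\<close>

definition fdom :: "('a \<Rightarrow> ereal) \<Rightarrow> 'a set"
  where "fdom f = {x. f x < \<infinity>}"

text \<open>Only meaningful at points of \<^term>\<open>fdom f\<close> where \<^term>\<open>f\<close> is differentiable.\<close>

definition grad :: "('a::euclidean_space \<Rightarrow> ereal) \<Rightarrow> 'a \<Rightarrow> 'a"
  where "grad f x = (THE D. GDERIV (\<lambda>y. real_of_ereal (f y)) x :> D)"

text \<open>
  The Hessian is the Frechet derivative of the gradient, as a linear map; its spectral norm is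
  \<^const>\<open>onorm\<close>.
\<close>

definition hess :: "('a::euclidean_space \<Rightarrow> ereal) \<Rightarrow> 'a \<Rightarrow> 'a \<Rightarrow> 'a"
  where "hess f x = frechet_derivative (grad f) (at x)"

text \<open>
  \<open>l : [0,\<infinity>) \<rightarrow> (0,\<infinity>)\<close> is a function on the reals whose values at negative arguments are irrelevant.
\<close>

definition l_smooth :: "(real \<Rightarrow> real) \<Rightarrow> ('a::euclidean_space \<Rightarrow> ereal) \<Rightarrow> bool"
  where "l_smooth l f \<longleftrightarrow>
    (\<forall>x\<in>fdom f. (\<lambda>y. real_of_ereal (f y)) differentiable (at x) \<and> grad f differentiable (at x)) \<and>
    continuous_on (closure (fdom f)) f \<and>
    (\<forall>s\<ge>0. l s > 0) \<and>
    mono_on {0..} l \<and>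
    (\<forall>s\<ge>0. \<exists>u>0. \<exists>L. L-lipschitz_on (cball s u \<inter> {0..}) l) \<and>
    (\<forall>x\<in>fdom f. onorm (hess f x) \<le> l (norm (grad f x)))"

definition stationary :: "('a::euclidean_space \<Rightarrow> ereal) \<Rightarrow> real \<Rightarrow> 'a \<Rightarrow> bool"
  where "stationary f \<epsilon> x \<longleftrightarrow> x \<in> fdom f \<and> (norm (grad f x))\<^sup>2 \<le> \<epsilon>"

text \<open>The real supremum is the intended one only if the set of ratios is bounded above.\<close>

definition doubling_ratio :: "(real \<Rightarrow> real) \<Rightarrow> real"
  where "doubling_ratio l = (SUP s\<in>{0..}. l (2 * s) / l s)"

definition step_size :: "(real \<Rightarrow> real) \<Rightarrow> 'a::euclidean_space \<Rightarrow> real"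
  where "step_size l g =
    1 / (5 * doubling_ratio l) * integral {0..1} (\<lambda>v. 1 / l (norm g + norm g * v))"

text \<open>
  One run of the method on samples \<open>z k j\<close>, where \<open>G x z\<close> is the stochastic gradient at \<open>x\<close>.
  The state after \<open>k\<close> iterations consists of the current point and the list of all stochastic
  gradients computed so far. The list is there to count the oracle calls.
\<close>

primrec sgd_state ::
  "(real \<Rightarrow> real) \<Rightarrow> ('a::euclidean_space \<Rightarrow> 'z \<Rightarrow> 'a) \<Rightarrow> nat \<Rightarrow> 'a \<Rightarrow> (nat \<Rightarrow> nat \<Rightarrow> 'z) \<Rightarrow> nat \<Rightarrow> 'a \<times> 'a list"
  where
    "sgd_state l G B x\<^sub>0 z 0 = (x\<^sub>0, [])"
  | "sgd_state l G B x\<^sub>0 z (Suc k) =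
      (let (x, computed) = sgd_state l G B x\<^sub>0 z k;
           gs = map (\<lambda>j. G x (z k j)) [1..<Suc B];
           g = (1 / real B) *\<^sub>R sum_list gs
       in (x - step_size l g *\<^sub>R g, computed @ gs))"

definition sgd_point ::
  "(real \<Rightarrow> real) \<Rightarrow> ('a::euclidean_space \<Rightarrow> 'z \<Rightarrow> 'a) \<Rightarrow> nat \<Rightarrow> 'a \<Rightarrow> (nat \<Rightarrow> nat \<Rightarrow> 'z) \<Rightarrow> nat \<Rightarrow> 'a"
  where "sgd_point l G B x\<^sub>0 z k = fst (sgd_state l G B x\<^sub>0 z k)"

definition sgd_computed ::
  "(real \<Rightarrow> real) \<Rightarrow> ('a::euclidean_space \<Rightarrow> 'z \<Rightarrow> 'a) \<Rightarrow> nat \<Rightarrow> 'a \<Rightarrow> (nat \<Rightarrow> nat \<Rightarrow> 'z) \<Rightarrow> nat \<Rightarrow> 'a list"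
  where "sgd_computed l G B x\<^sub>0 z k = snd (sgd_state l G B x\<^sub>0 z k)"

end

theory Submission imports Defs begin

text \<open>
  Call a batch good if its mean \<open>g\<close> lies within \<open>sqrt \<epsilon> / 4\<close> of the true gradient. As long as no
  iterate is \<open>\<epsilon>\<close>-stationary, the gradient norm \<open>a\<close> exceeds \<open>sqrt \<epsilon>\<close>, so a good batch has relative
  error at most \<open>1/4\<close>. The statement then splits into a deterministic and a probabilistic part.

  Deterministically (\<open>descent_step\<close>), a step with relative error at most \<open>1/4\<close> stays in the domain
  and decreases the objective by at least \<open>a\<^sup>2 / (20 r l(3 a))\<close>. The reason is that the step size is at
  most \<open>1 / (5 r l(\<parallel>g\<parallel>))\<close>: while the gradient norm stays below \<open>2 \<parallel>g\<parallel>\<close>, the Hessian is bounded by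
  \<open>l(2 \<parallel>g\<parallel>) \<le> r l(\<parallel>g\<parallel>)\<close>, hence along the whole step the gradient moves by no more than \<open>\<parallel>g\<parallel>/5\<close>, and
  this in turn keeps its norm strictly below \<open>2 \<parallel>g\<parallel>\<close>. A point of first exit from this regime, or
  from the domain, can therefore not exist. Telescoping over \<open>T\<close> good steps yields the inequality on
  the minimum from which \<open>T\<close> is defined (\<open>min_gradient_bound\<close>), and so a stationary iterate.

  Probabilistically (\<open>sum_iid_light_tail\<close>), a sum \<open>S\<close> of \<open>n\<close> independent centred vectors with
  \<open>E exp(\<parallel>X\<parallel>\<^sup>2/\<sigma>\<^sup>2) \<le> e\<close> satisfies \<open>P(\<parallel>S\<parallel> \<ge> sqrt 2 (1 + b) \<sigma> sqrt n) \<le> exp(-b\<^sup>2/3)\<close>. For \<open>b \<le> 1\<close> this is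
  Chebyshev's inequality. For \<open>b > 1\<close> it comes from the Pinelis argument: in an inner product space
  \<open>cosh \<parallel>s + x\<parallel>\<close> is at most \<open>cosh \<parallel>s\<parallel> (exp \<parallel>x\<parallel> - \<parallel>x\<parallel>)\<close> plus a term linear in \<open>x\<close>, so
  \<open>E cosh(t \<parallel>S\<parallel>)\<close> grows by a factor of at most \<open>exp(t\<^sup>2 \<sigma>\<^sup>2)\<close> per summand, independently of the
  dimension. The batch size makes the failure probability of one batch at most \<open>\<delta>/T\<close>, conditionally
  on the past (\<open>bad_batch_prob\<close>), and a union bound over the \<open>T\<close> batches concludes.
\<close>

section \<open>A dimension-free exponential inequality for norms\<close>

text \<open>
  The power series of \<open>cosh (sqrt z)\<close> is \<open>\<Sum>k. z ^ k / (2 k)!\<close>, a sum of convex functions on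
  the nonnegative reals.
\<close>

lemma cosh_sqrt_convex:
  fixes a b p q :: real
  assumes "0 \<le> a" "0 \<le> b" "0 \<le> p" "0 \<le> q" "p + q = 1"
  shows "cosh (sqrt (p * a + q * b)) \<le> p * cosh (sqrt a) + q * cosh (sqrt b)"
proof -
  define t :: "real \<Rightarrow> nat \<Rightarrow> real"
    where "t z n = (if even n then z ^ (n div 2) / fact n else 0)" for z n
  have sums: "t z sums cosh (sqrt z)" if "0 \<le> z" for z
  proof -
    have "(\<lambda>n. if even n then sqrt z ^ n /\<^sub>R fact n else 0) = t z"
      using that by (auto simp: t_def fun_eq_iff power_mult divide_inverse elim!: evenE)
    with cosh_converges[of "sqrt z"] show ?thesis by simp
  qed
  have "(\<lambda>n. p * t a n + q * t b n) sums (p * cosh (sqrt a) + q * cosh (sqrt b))"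
    using assms by (intro sums_add sums_mult sums) auto
  moreover have "t (p * a + q * b) n \<le> p * t a n + q * t b n" for n
  proof -
    have "(p * a + q * b) ^ k \<le> p * a ^ k + q * b ^ k" for k
    proof -
      have "\<forall>x\<in>{0..}. \<forall>y\<in>{0..}. \<forall>u\<ge>0. \<forall>v\<ge>0. u + v = 1 \<longrightarrow>
          (u *\<^sub>R x + v *\<^sub>R y) ^ k \<le> u * x ^ k + v * (y::real) ^ k"
        using convex_power_odd[of k] convex_on_subset[OF convex_power_even[of k], of "{0..}"]
        unfolding convex_on_def by blast
      with assms show ?thesis by simp
    qed
    then show ?thesis
      by (auto simp: t_def add_divide_distrib[symmetric] divide_right_mono)
  qed
  ultimately show ?thesis
    using assms by (intro sums_le[OF _ sums]) auto
qed

lemma le_sinh: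
  fixes y :: real
  assumes "0 \<le> y"
  shows "y \<le> sinh y"
proof -
  have "sinh 0 - 0 \<le> sinh y - y"
    by (rule DERIV_nonneg_imp_nondecreasing[OF assms])
      (auto intro!: derivative_eq_intros exI cosh_real_ge_1 simp: diff_ge_0_iff_ge)
  then show ?thesis by simp
qed

text \<open>
  For fixed norms of \<open>s\<close> and \<open>x\<close>, the square of \<open>norm (s + x)\<close> is affine in the cosine \<open>c\<close> of the
  angle between them. By convexity of \<open>cosh \<circ> sqrt\<close> the left-hand side is convex in \<open>c\<close>, while the
  right-hand side is affine in \<open>c\<close>. It is thus enough to compare the two at \<open>c = 1\<close> and \<open>c = -1\<close>,
  where the addition theorems reduce the claim to \<open>y \<le> sinh y\<close>.
\<close>

lemma cosh_norm_add_le: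
  fixes s x :: "'a::real_inner"
  shows "cosh (norm (s + x)) \<le>
    cosh (norm s) * (exp (norm x) - norm x) + (sinh (norm s) / norm s) * (s \<bullet> x)"
proof -
  \<comment> \<open>if \<open>s\<close> or \<open>x\<close> vanishes then \<open>c = 0\<close> by division by zero, and the identity for \<open>s \<bullet> x\<close> below survives\<close>
  define u y c where "u = norm s" and "y = norm x" and "c = (s \<bullet> x) / (norm s * norm x)"
  have sx: "s \<bullet> x = u * y * c" by (auto simp: u_def y_def c_def)
  have "\<bar>c\<bar> \<le> 1"
    using Cauchy_Schwarz_ineq2[of s x] by (auto simp: c_def divide_le_eq)
  then have c: "-1 \<le> c" "c \<le> 1" by auto
  \<comment> \<open>the weights that represent \<open>c\<close> as a convex combination of the extreme cosines \<open>1\<close> and \<open>-1\<close>\<close>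
  define p q where "p = (1 + c) / 2" and "q = (1 - c) / 2"
  have pq: "0 \<le> p" "0 \<le> q" "p + q = 1" "c = p - q" using c by (auto simp: p_def q_def field_simps)
  have sh: "y \<le> sinh y" by (rule le_sinh) (simp add: y_def)
  have "norm (s + x) = sqrt ((norm (s + x))\<^sup>2)" by simp
  also have "(norm (s + x))\<^sup>2 = u\<^sup>2 + y\<^sup>2 + 2 * (s \<bullet> x)"
    by (simp add: u_def y_def power2_norm_eq_inner inner_commute algebra_simps)
  also have "\<dots> = (p + q) * (u\<^sup>2 + y\<^sup>2) + 2 * (u * y * (p - q))"
    by (simp only: sx pq mult_1)
  also have "\<dots> = p * (u + y)\<^sup>2 + q * (u - y)\<^sup>2"
    by (simp add: power2_eq_square algebra_simps)
  finally have "cosh (norm (s + x)) \<le> p * cosh (u + y) + q * cosh (u - y)"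
    using cosh_sqrt_convex[of "(u + y)\<^sup>2" "(u - y)\<^sup>2" p q] pq by simp
  also have "cosh (u + y) \<le> cosh u * (exp y - y) + sinh u * y"
  proof -
    have "0 \<le> (cosh u - sinh u) * (sinh y - y)"
      using sh by (intro mult_nonneg_nonneg) (auto simp: cosh_minus_sinh)
    then show ?thesis
      unfolding cosh_add cosh_plus_sinh[of y, symmetric] by (simp add: algebra_simps)
  qed
  also have "cosh (u - y) \<le> cosh u * (exp y - y) - sinh u * y"
  proof -
    have "0 \<le> (cosh u + sinh u) * (sinh y - y)"
      using sh by (intro mult_nonneg_nonneg) (auto simp: cosh_plus_sinh)
    then show ?thesis
      unfolding cosh_diff cosh_plus_sinh[of y, symmetric] by (simp add: algebra_simps)
  qed
  finally have "cosh (norm (s + x)) \<le> p * (cosh u * (exp y - y) + sinh u * y) +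
      q * (cosh u * (exp y - y) - sinh u * y)"
    using pq by (simp add: mult_left_mono)
  also have "\<dots> = (p + q) * (cosh u * (exp y - y)) + (p - q) * (sinh u * y)"
    by (simp add: algebra_simps)
  also have "\<dots> = cosh u * (exp y - y) + (sinh u / u) * (s \<bullet> x)"
    by (cases "u = 0") (simp_all add: pq(3) sx pq(4))
  finally show ?thesis by (simp add: u_def y_def)
qed


lemma exp_le_add_exp_square:
  fixes y :: real
  assumes "0 \<le> y"
  shows "exp y \<le> y + exp (y\<^sup>2)"
proof (cases "y \<le> 1")
  case True
  then have "exp y \<le> 1 + y + y\<^sup>2" using assms exp_bound by auto
  moreover have "1 + y\<^sup>2 \<le> exp (y\<^sup>2)" by (rule exp_ge_add_one_self)
  ultimately show ?thesis by linarith
next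
  case False
  then have "y \<le> y\<^sup>2" by (simp add: power2_eq_square)
  then show ?thesis using assms by (smt (verit) exp_le_cancel_iff)
qed

text \<open>
  A pointwise substitute for Jensen's inequality: if \<open>E exp W \<le> e\<close>, taking expectations gives
  \<open>E exp(p W) \<le> exp p\<close>.
\<close>

lemma exp_mult_le:
  fixes p w :: real
  assumes "0 \<le> p" "p \<le> 1"
  shows "exp (p * w) \<le> exp p * (1 - p + p * exp (w - 1))"
proof -
  have "exp (p *\<^sub>R (w - 1) + (1 - p) *\<^sub>R 0) \<le> p * exp (w - 1) + (1 - p) * exp 0"
    using exp_convex assms unfolding convex_on_def by (metis UNIV_I add_diff_cancel_left' diff_ge_0_iff_ge le_add_diff_inverse)
  then have "exp p * exp (p * (w - 1)) \<le> exp p * (1 - p + p * exp (w - 1))"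
    by (intro mult_left_mono) auto
  moreover have "exp (p * w) = exp p * exp (p * (w - 1))"
    by (simp add: exp_add[symmetric] algebra_simps)
  ultimately show ?thesis by simp
qed

text \<open>
  The bound is chosen so that it integrates to at most \<open>exp (t\<^sup>2)\<close> whenever
  \<open>E exp (Y\<^sup>2) \<le> e\<close>, for every \<open>t\<close>. If \<open>t \<le> 1\<close>, the left-hand side is at most \<open>exp(t\<^sup>2 y\<^sup>2)\<close>
  and the weight \<open>p = t\<^sup>2\<close> fits. If \<open>t > 1\<close>, it is at most \<open>exp(t\<^sup>2/2 + y\<^sup>2/2)\<close>, which calls for
  \<open>p = 1/2\<close>, and the resulting constant \<open>exp(t\<^sup>2/2 + 1/2)\<close> is below \<open>exp (t\<^sup>2)\<close>.
\<close>

lemma exp_minus_self_le_tilt: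
  fixes t :: real
  assumes "0 \<le> t"
  obtains p where "0 \<le> p" "p \<le> 1" 
    "\<And>y. 0 \<le> y \<Longrightarrow> exp (t * y) - t * y \<le> exp (t\<^sup>2) * (1 - p + p * exp (y\<^sup>2 - 1))"
proof (cases "t \<le> 1")
  case True
  show ?thesis
  proof (rule that[of "t\<^sup>2"])
    fix y :: real assume "0 \<le> y"
    then have "exp (t * y) - t * y \<le> exp (t\<^sup>2 * y\<^sup>2)"
      using exp_le_add_exp_square[of "t * y"] assms by (simp add: power_mult_distrib)
    also have "\<dots> \<le> exp (t\<^sup>2) * (1 - t\<^sup>2 + t\<^sup>2 * exp (y\<^sup>2 - 1))"
      using True assms by (intro exp_mult_le) (auto simp: power_le_one)
    finally show "exp (t * y) - t * y \<le> exp (t\<^sup>2) * (1 - t\<^sup>2 + t\<^sup>2 * exp (y\<^sup>2 - 1))" .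
  qed (use True assms in \<open>auto simp: power_le_one\<close>)
next
  case False
  show ?thesis
  proof (rule that[of "1 / 2"])
    fix y :: real assume "0 \<le> y"
    have "0 \<le> (t - y)\<^sup>2" by simp
    then have "t * y \<le> t\<^sup>2 / 2 + 1 / 2 * y\<^sup>2"
      by (simp add: power2_eq_square algebra_simps)
    then have "exp (t * y) \<le> exp (t\<^sup>2 / 2) * exp (1 / 2 * y\<^sup>2)"
      unfolding exp_add[symmetric] exp_le_cancel_iff .
    also have "\<dots> \<le> exp (t\<^sup>2 / 2) * (exp (1 / 2) * (1 - 1 / 2 + 1 / 2 * exp (y\<^sup>2 - 1)))"
      by (intro mult_left_mono exp_mult_le) auto
    also have "\<dots> = exp (t\<^sup>2 / 2 + 1 / 2) * (1 - 1 / 2 + 1 / 2 * exp (y\<^sup>2 - 1))"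
      by (simp only: exp_add mult.assoc)
    also have "\<dots> \<le> exp (t\<^sup>2) * (1 - 1 / 2 + 1 / 2 * exp (y\<^sup>2 - 1))"
    proof (intro mult_right_mono)
      have "1 \<le> t\<^sup>2" using False by (simp add: one_le_power)
      then show "exp (t\<^sup>2 / 2 + 1 / 2) \<le> exp (t\<^sup>2)" by simp
    qed auto
    finally show "exp (t * y) - t * y \<le> exp (t\<^sup>2) * (1 - 1 / 2 + 1 / 2 * exp (y\<^sup>2 - 1))"
      using assms \<open>0 \<le> y\<close> mult_nonneg_nonneg[of t y] by linarith
  qed auto
qed


section \<open>Tails of sums of independent light-tailed vectors\<close>

lemma light_tail_integrable_exp:
  fixes X :: "'z \<Rightarrow> 'a::euclidean_space"
  assumes [measurable]: "X \<in> borel_measurable D"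
    and light: "(\<integral>\<^sup>+z. ennreal (exp ((norm (X z))\<^sup>2)) \<partial>D) \<le> ennreal (exp 1)"
  shows "integrable D (\<lambda>z. exp ((norm (X z))\<^sup>2 - 1))" "(\<integral>z. exp ((norm (X z))\<^sup>2 - 1) \<partial>D) \<le> 1"
    and "integrable D X"
proof -
  have int: "integrable D (\<lambda>z. exp ((norm (X z))\<^sup>2))"
    using light by (intro integrableI_nonneg) (auto simp: top_unique less_top[symmetric])
  then show "integrable D (\<lambda>z. exp ((norm (X z))\<^sup>2 - 1))"
    by (simp add: exp_diff)
  have "(\<integral>z. exp ((norm (X z))\<^sup>2) \<partial>D) \<le> exp 1"
    using light int by (subst (asm) nn_integral_eq_integral) auto
  then show "(\<integral>z. exp ((norm (X z))\<^sup>2 - 1) \<partial>D) \<le> 1"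
    by (simp add: exp_diff)
  have "norm (X z) \<le> exp ((norm (X z))\<^sup>2)" for z
  proof -
    have "0 \<le> (norm (X z) - 1 / 2)\<^sup>2" by simp
    then have "norm (X z) \<le> 1 + (norm (X z))\<^sup>2" by (simp add: power2_eq_square algebra_simps)
    also have "\<dots> \<le> exp ((norm (X z))\<^sup>2)" by (rule exp_ge_add_one_self)
    finally show ?thesis .
  qed
  then show "integrable D X"
    by (intro Bochner_Integration.integrable_bound[OF int]) auto
qed

text \<open>
  Adding an independent centred summand multiplies \<open>E cosh (t \<parallel>S\<parallel>)\<close> by at most \<open>exp (t\<^sup>2)\<close>: the
  linear term of \<open>cosh_norm_add_le\<close> has mean zero.
\<close>

lemma (in prob_space) cosh_norm_shift_light_tail:
  fixes X :: "'a \<Rightarrow> 'b::euclidean_space"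
  assumes X[measurable]: "X \<in> borel_measurable M"
    and mean: "expectation X = 0"
    and light: "(\<integral>\<^sup>+z. ennreal (exp ((norm (X z))\<^sup>2)) \<partial>M) \<le> ennreal (exp 1)"
    and t: "0 \<le> t"
  shows "(\<integral>\<^sup>+z. ennreal (cosh (t * norm (s + X z))) \<partial>M) \<le> ennreal (exp (t\<^sup>2)) * ennreal (cosh (t * norm s))"
proof -
  note int = light_tail_integrable_exp[OF X light]
  obtain p where p: "0 \<le> p" "p \<le> 1"
    "\<And>y. 0 \<le> y \<Longrightarrow> exp (t * y) - t * y \<le> exp (t\<^sup>2) * (1 - p + p * exp (y\<^sup>2 - 1))"
    using exp_minus_self_le_tilt[OF t] by blast
  define v where "v = (sinh (norm (t *\<^sub>R s)) / norm (t *\<^sub>R s) * t) *\<^sub>R (t *\<^sub>R s)"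
  define R where "R z = cosh (t * norm s) * (exp (t\<^sup>2) * (1 - p + p * exp ((norm (X z))\<^sup>2 - 1)))
    + v \<bullet> X z" for z
  have le: "cosh (t * norm (s + X z)) \<le> R z" for z
  proof -
    have "t * norm (s + X z) = norm (t *\<^sub>R s + t *\<^sub>R X z)"
      using t by (simp flip: scaleR_add_right)
    then have "cosh (t * norm (s + X z)) \<le>
        cosh (t * norm s) * (exp (t * norm (X z)) - t * norm (X z)) + v \<bullet> X z"
      using cosh_norm_add_le[of "t *\<^sub>R s" "t *\<^sub>R X z"] t by (auto simp: v_def mult_ac)
    also have "\<dots> \<le> R z"
      unfolding R_def by (intro add_right_mono mult_left_mono p(3)) auto
    finally show ?thesis .
  qed
  have nonneg: "0 \<le> R z" for z
    by (rule order_trans[OF _ le]) simp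
  have "integrable M R" unfolding R_def using int by simp
  have "expectation R = cosh (t * norm s) *
      (exp (t\<^sup>2) * (1 - p + p * expectation (\<lambda>z. exp ((norm (X z))\<^sup>2 - 1))))"
    unfolding R_def using int mean by (simp add: prob_space)
  also have "\<dots> \<le> cosh (t * norm s) * (exp (t\<^sup>2) * (1 - p + p * 1))"
    by (intro mult_left_mono add_left_mono int p(1)) auto
  finally have *: "expectation R \<le> exp (t\<^sup>2) * cosh (t * norm s)" by (simp add: mult.commute)
  have "(\<integral>\<^sup>+z. ennreal (cosh (t * norm (s + X z))) \<partial>M) \<le> (\<integral>\<^sup>+z. ennreal (R z) \<partial>M)"
    using le by (intro nn_integral_mono ennreal_leI) auto
  also have "\<dots> = ennreal (expectation R)"
    using \<open>integrable M R\<close> nonneg by (intro nn_integral_eq_integral) auto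
  also have "\<dots> \<le> ennreal (exp (t\<^sup>2) * cosh (t * norm s))" by (rule ennreal_leI[OF *])
  finally show ?thesis by (simp add: ennreal_mult')
qed

lemma (in prob_space) square_norm_shift_light_tail:
  fixes X :: "'a \<Rightarrow> 'b::euclidean_space"
  assumes X[measurable]: "X \<in> borel_measurable M"
    and mean: "expectation X = 0"
    and light: "(\<integral>\<^sup>+z. ennreal (exp ((norm (X z))\<^sup>2)) \<partial>M) \<le> ennreal (exp 1)"
  shows "(\<integral>\<^sup>+z. ennreal ((norm (s + X z))\<^sup>2) \<partial>M) \<le> ennreal ((norm s)\<^sup>2) + 1"
proof -
  note int = light_tail_integrable_exp[OF X light]
  define R where "R z = (norm s)\<^sup>2 + exp ((norm (X z))\<^sup>2 - 1) + (2 *\<^sub>R s) \<bullet> X z" for z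
  have le: "(norm (s + X z))\<^sup>2 \<le> R z" for z
  proof -
    have "(norm (s + X z))\<^sup>2 = (norm s)\<^sup>2 + (norm (X z))\<^sup>2 + (2 *\<^sub>R s) \<bullet> X z"
      by (simp add: power2_norm_eq_inner inner_commute algebra_simps)
    then show ?thesis
      using exp_ge_add_one_self[of "(norm (X z))\<^sup>2 - 1"] by (simp add: R_def)
  qed
  have nonneg: "0 \<le> R z" for z
    by (rule order_trans[OF _ le]) simp
  have "integrable M R" unfolding R_def using int by simp
  have "expectation R = (norm s)\<^sup>2 + expectation (\<lambda>z. exp ((norm (X z))\<^sup>2 - 1))"
    unfolding R_def using int mean by (simp add: prob_space)
  also have "\<dots> \<le> (norm s)\<^sup>2 + 1" using int by simp
  finally have *: "expectation R \<le> (norm s)\<^sup>2 + 1" .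
  have "(\<integral>\<^sup>+z. ennreal ((norm (s + X z))\<^sup>2) \<partial>M) \<le> (\<integral>\<^sup>+z. ennreal (R z) \<partial>M)"
    using le by (intro nn_integral_mono ennreal_leI) auto
  also have "\<dots> = ennreal (expectation R)"
    using \<open>integrable M R\<close> nonneg by (intro nn_integral_eq_integral) auto
  also have "\<dots> \<le> ennreal ((norm s)\<^sup>2 + 1)" by (rule ennreal_leI[OF *])
  finally show ?thesis by simp
qed

text \<open>
  A one-step bound for the expectation of \<open>F (s + X)\<close> that is affine in \<open>F s\<close> can be iterated over
  the summands. It serves both the second moment (\<open>a = c = 1\<close>) and the hyperbolic cosine
  (\<open>a = exp (t\<^sup>2)\<close>, \<open>c = 0\<close>).
\<close>

lemma nn_integral_sum_iid_le:
  fixes X :: "'z \<Rightarrow> 'a::euclidean_space" and F :: "'a \<Rightarrow> ennreal"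
  assumes D: "prob_space D"
    and [measurable]: "X \<in> borel_measurable D" "F \<in> borel_measurable borel"
    and step: "\<And>s. (\<integral>\<^sup>+z. F (s + X z) \<partial>D) \<le> a * F s + c"
    and "finite J"
  shows "(\<integral>\<^sup>+q. F (\<Sum>j\<in>J. X (q j)) \<partial>(PiM J (\<lambda>_. D))) \<le> ((\<lambda>u. a * u + c) ^^ card J) (F 0)"
  using \<open>finite J\<close>
proof (induction J)
  case empty
  then show ?case by (simp add: PiM_empty nn_integral_count_space_finite)
next
  case (insert i J)
  interpret D: prob_space D by fact
  interpret product_sigma_finite "\<lambda>_. D" by unfold_locales
  interpret J: prob_space "PiM J (\<lambda>_. D)" by (intro prob_space_PiM D)
  have "(\<integral>\<^sup>+q. F (\<Sum>j\<in>insert i J. X (q j)) \<partial>(PiM (insert i J) (\<lambda>_. D))) =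
      (\<integral>\<^sup>+q. \<integral>\<^sup>+z. F (\<Sum>j\<in>insert i J. X ((q(i := z)) j)) \<partial>D \<partial>(PiM J (\<lambda>_. D)))"
    using insert.hyps by (intro product_nn_integral_insert) auto
  also have "\<dots> = (\<integral>\<^sup>+q. \<integral>\<^sup>+z. F ((\<Sum>j\<in>J. X (q j)) + X z) \<partial>D \<partial>(PiM J (\<lambda>_. D)))"
    using insert.hyps by (intro nn_integral_cong arg_cong[where f=F]) (auto simp: add.commute intro!: sum.cong)
  also have "\<dots> \<le> (\<integral>\<^sup>+q. a * F (\<Sum>j\<in>J. X (q j)) + c \<partial>(PiM J (\<lambda>_. D)))"
    by (intro nn_integral_mono step)
  also have "\<dots> = a * (\<integral>\<^sup>+q. F (\<Sum>j\<in>J. X (q j)) \<partial>(PiM J (\<lambda>_. D))) + c"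
    by (simp add: nn_integral_add nn_integral_cmult J.emeasure_space_1)
  also have "\<dots> \<le> a * ((\<lambda>u. a * u + c) ^^ card J) (F 0) + c"
    by (intro add_right_mono mult_left_mono insert.IH) auto
  finally show ?case using insert.hyps by simp
qed

text \<open>
  Markov's inequality for \<open>cosh (t \<parallel>S\<parallel>)\<close> at the optimal \<open>t\<close> gives \<open>2 exp (- (1 + b)\<^sup>2 / 2)\<close>. The
  factor \<open>2\<close> spoils this bound for small \<open>b\<close>; there the second moment gives
  \<open>1 / (2 (1 + b)\<^sup>2) \<le> 1/2\<close>, which is smaller than \<open>exp (- b\<^sup>2 / 3)\<close> up to \<open>b = 1\<close>.
\<close>

lemma sum_iid_light_tail_normalized:
  fixes X :: "'z \<Rightarrow> 'a::euclidean_space"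
  assumes D: "prob_space D"
    and X[measurable]: "X \<in> borel_measurable D"
    and mean: "(\<integral>z. X z \<partial>D) = 0"
    and light: "(\<integral>\<^sup>+z. ennreal (exp ((norm (X z))\<^sup>2)) \<partial>D) \<le> ennreal (exp 1)"
    and J: "finite J" "J \<noteq> {}" and b: "0 \<le> b"
  shows "emeasure (PiM J (\<lambda>_. D)) {q \<in> space (PiM J (\<lambda>_. D)).
      sqrt 2 * (1 + b) * sqrt (real (card J)) \<le> norm (\<Sum>j\<in>J. X (q j))} \<le> ennreal (exp (- b\<^sup>2 / 3))"
    (is "emeasure ?P ?E \<le> _")
proof -
  interpret D: prob_space D by fact
  define n where "n = real (card J)"
  have n: "n \<ge> 1" using J by (auto simp: n_def Suc_le_eq card_gt_0_iff)
  define S where "S q = (\<Sum>j\<in>J. X (q j))" for q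
  have [measurable]: "S \<in> borel_measurable ?P" unfolding S_def by measurable
  define a where "a = sqrt 2 * (1 + b) * sqrt n"
  have a: "a > 0" using b n by (auto simp: a_def)
  have E: "?E = {q \<in> space ?P. a \<le> norm (S q)}" by (simp add: a_def n_def S_def)
  have markov: "emeasure ?P ?E \<le> ennreal (C / \<phi> a)"
    if "\<phi> \<in> borel_measurable borel" "\<And>u. a \<le> u \<Longrightarrow> \<phi> a \<le> \<phi> u" "\<phi> a > 0" "C \<ge> 0"
      and C: "(\<integral>\<^sup>+q. ennreal (\<phi> (norm (S q))) \<partial>?P) \<le> ennreal C" for \<phi> C
  proof -
    note [measurable] = \<open>\<phi> \<in> borel_measurable borel\<close>
    have "emeasure ?P ?E \<le> emeasure ?P {q \<in> space ?P. 1 \<le> ennreal (1 / \<phi> a) * ennreal (\<phi> (norm (S q)))}"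
    proof (rule emeasure_mono)
      show "?E \<subseteq> {q \<in> space ?P. 1 \<le> ennreal (1 / \<phi> a) * ennreal (\<phi> (norm (S q)))}"
        unfolding E using that by (auto simp: ennreal_mult'[symmetric] le_divide_eq)
    qed measurable
    also have "\<dots> \<le> ennreal (1 / \<phi> a) * (\<integral>\<^sup>+q. ennreal (\<phi> (norm (S q))) * indicator (space ?P) q \<partial>?P)"
      using nn_integral_Markov_inequality[of "\<lambda>q. ennreal (\<phi> (norm (S q)))" "space ?P" ?P "ennreal (1 / \<phi> a)"]
      by simp
    also have "\<dots> \<le> ennreal (1 / \<phi> a) * ennreal C"
      using C by (intro mult_left_mono) (auto cong: nn_integral_cong)
    also have "\<dots> = ennreal (C / \<phi> a)" using that by (simp add: ennreal_mult'[symmetric])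
    finally show ?thesis .
  qed
  show ?thesis
  proof (cases "b \<le> 1")
    case True
    have "((\<lambda>u. 1 * u + 1) ^^ k) (0::ennreal) = of_nat k" for k
      by (induction k) (auto simp: add.commute)
    then have "(\<integral>\<^sup>+q. ennreal ((norm (S q))\<^sup>2) \<partial>?P) \<le> ennreal n"
      using nn_integral_sum_iid_le[OF D X, of "\<lambda>s. ennreal ((norm s)\<^sup>2)" 1 1 J]
        D.square_norm_shift_light_tail[OF X mean light] J
      by (simp add: S_def n_def ennreal_of_nat_eq_real_of_nat)
    with a n have "emeasure ?P ?E \<le> ennreal (n / a\<^sup>2)"
      by (intro markov) (auto intro!: power_mono)
    also have "n / a\<^sup>2 \<le> exp (- b\<^sup>2 / 3)"
    proof -
      have "n / a\<^sup>2 = 1 / (2 * (1 + b)\<^sup>2)"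
        using n by (simp add: a_def power_mult_distrib)
      also have "\<dots> \<le> 1 / 2" using b by (simp add: divide_simps one_le_power)
      also have "1 / 2 \<le> 1 + - b\<^sup>2 / 3" using True b power_le_one[of b 2] by simp
      also have "\<dots> \<le> exp (- b\<^sup>2 / 3)" by (rule exp_ge_add_one_self)
      finally show ?thesis .
    qed
    finally show ?thesis by (simp add: ennreal_leI)
  next
    case False
    \<comment> \<open>the minimiser \<open>a / (2 n)\<close> of the exponent \<open>n t\<^sup>2 - t a\<close>\<close>
    define t where "t = (1 + b) / (sqrt 2 * sqrt n)"
    have t: "t > 0" using b n by (simp add: t_def)
    have pow: "((\<lambda>u. ennreal (exp (t\<^sup>2)) * u + 0) ^^ k) 1 = ennreal (exp (real k * t\<^sup>2))" for k
      by (induction k) (auto simp: ennreal_mult'[symmetric] exp_add[symmetric] algebra_simps)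
    have "(\<lambda>s::'a. cosh (t * norm s)) \<in> borel_measurable borel"
      by (intro borel_measurable_continuous_onI continuous_intros)
    then have "(\<integral>\<^sup>+q. ennreal (cosh (t * norm (S q))) \<partial>?P) \<le> ennreal (exp (n * t\<^sup>2))"
      using nn_integral_sum_iid_le[OF D X, of "\<lambda>s. ennreal (cosh (t * norm s))" "ennreal (exp (t\<^sup>2))" 0 J]
        D.cosh_norm_shift_light_tail[OF X mean light, of t] J t pow
      by (simp add: S_def n_def)
    with a n t have "emeasure ?P ?E \<le> ennreal (exp (n * t\<^sup>2) / cosh (t * a))"
      by (intro markov borel_measurable_continuous_onI continuous_intros)
        (auto simp: cosh_real_nonneg_le_iff)
    also have "exp (n * t\<^sup>2) / cosh (t * a) \<le> exp (- b\<^sup>2 / 3)"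
    proof -
      have nt: "n * t\<^sup>2 = (1 + b)\<^sup>2 / 2" using n by (simp add: t_def power_divide power_mult_distrib)
      have ta: "t * a = (1 + b)\<^sup>2" using n by (simp add: t_def a_def power2_eq_square)
      have "exp ((1 + b)\<^sup>2) \<le> 2 * cosh ((1 + b)\<^sup>2)" by (simp add: cosh_def)
      then have "exp (n * t\<^sup>2) / cosh (t * a) \<le> exp ((1 + b)\<^sup>2 / 2) / (exp ((1 + b)\<^sup>2) / 2)"
        unfolding nt ta by (intro divide_left_mono) auto
      also have "\<dots> = 2 * exp (- ((1 + b)\<^sup>2 / 2))"
        by (simp add: exp_minus exp_add[symmetric] field_simps)
      also have "\<dots> \<le> exp 1 * exp (- ((1 + b)\<^sup>2 / 2))"
        using exp_ge_add_one_self[of 1] by (intro mult_right_mono) auto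
      also have "\<dots> \<le> exp (- b\<^sup>2 / 3)"
      proof -
        have "1 + - ((1 + b)\<^sup>2 / 2) = 1 / 2 - b - b\<^sup>2 / 2"
          by (simp add: power2_eq_square field_simps)
        also have "\<dots> \<le> - b\<^sup>2 / 3" using False zero_le_power2[of b] by linarith
        finally show ?thesis by (simp flip: exp_add)
      qed
      finally show ?thesis .
    qed
    finally show ?thesis by (simp add: ennreal_leI)
  qed
qed

lemma sum_iid_light_tail:
  fixes X :: "'z \<Rightarrow> 'a::euclidean_space"
  assumes D: "prob_space D"
    and X[measurable]: "X \<in> borel_measurable D"
    and mean: "(\<integral>z. X z \<partial>D) = 0"
    and light: "(\<integral>\<^sup>+z. ennreal (exp ((norm (X z))\<^sup>2 / \<sigma>\<^sup>2)) \<partial>D) \<le> ennreal (exp 1)"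
    and J: "finite J" "J \<noteq> {}" and b: "0 \<le> b" and \<sigma>: "0 < \<sigma>"
  shows "emeasure (PiM J (\<lambda>_. D)) {q \<in> space (PiM J (\<lambda>_. D)).
      sqrt 2 * (1 + b) * \<sigma> * sqrt (real (card J)) \<le> norm (\<Sum>j\<in>J. X (q j))} \<le> ennreal (exp (- b\<^sup>2 / 3))"
proof -
  have "sqrt 2 * (1 + b) * \<sigma> * sqrt (real (card J)) \<le> norm (\<Sum>j\<in>J. X (q j)) \<longleftrightarrow>
      sqrt 2 * (1 + b) * sqrt (real (card J)) \<le> norm (\<Sum>j\<in>J. (1 / \<sigma>) *\<^sub>R X (q j))" for q
    using \<sigma> by (simp add: scaleR_sum_right[symmetric] field_simps)
  then show ?thesis
    using sum_iid_light_tail_normalized[OF D, of "\<lambda>z. (1 / \<sigma>) *\<^sub>R X z" J b] assms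
    by (simp add: power_divide)
qed

section \<open>One step under generalized smoothness\<close>

locale generalized_smooth =
  fixes f :: "'a::euclidean_space \<Rightarrow> ereal" and l :: "real \<Rightarrow> real"
  assumes not_MInf: "\<And>y. f y \<noteq> -\<infinity>"
    and open_fdom: "open (fdom f)"
    and smooth: "l_smooth l f"
    and ratio_bdd: "bdd_above ((\<lambda>s. l (2 * s) / l s) ` {0..})"
begin

abbreviation F :: "'a \<Rightarrow> real" where "F y \<equiv> real_of_ereal (f y)"

lemma f_eq_ereal_F: "y \<in> fdom f \<Longrightarrow> f y = ereal (F y)"
  using not_MInf[of y] by (cases "f y") (auto simp: fdom_def)

text \<open>
  On the domain the definite description in \<open>grad\<close> denotes: a linear functional on a
  Euclidean space is represented by exactly one vector.
\<close>

lemma F_has_derivative: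
  assumes "x \<in> fdom f"
  shows "(F has_derivative (\<lambda>h. h \<bullet> grad f x)) (at x)"
proof -
  from assms smooth obtain F' where F': "(F has_derivative F') (at x)"
    by (auto simp: l_smooth_def differentiable_def)
  define D where "D = (\<Sum>b\<in>Basis. F' b *\<^sub>R b)"
  have "F' = (\<lambda>h. h \<bullet> D)"
  proof
    fix h
    have "F' (\<Sum>b\<in>Basis. (h \<bullet> b) *\<^sub>R b) = (\<Sum>b\<in>Basis. (h \<bullet> b) * F' b)"
      using has_derivative_linear[OF F'] by (simp add: linear_sum linear_scale)
    also have "\<dots> = h \<bullet> D" by (simp add: D_def inner_sum_right mult.commute)
    finally show "F' h = h \<bullet> D" by (simp add: euclidean_representation)
  qed
  with F' have "GDERIV F x :> D" by (simp add: gderiv_def)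
  moreover have "E = D" if "GDERIV F x :> E" for E
  proof -
    have "h \<bullet> E = h \<bullet> D" for h
      using has_derivative_unique[of F "\<lambda>h. h \<bullet> E" x "\<lambda>h. h \<bullet> D"] that \<open>GDERIV F x :> D\<close>
      by (auto simp: gderiv_def fun_eq_iff)
    then show ?thesis using vector_eq_ldot[of E D] by blast
  qed
  ultimately have "GDERIV F x :> grad f x"
    unfolding grad_def by (rule theI)
  then show ?thesis by (simp add: gderiv_def)
qed

lemma DERIV_F_along_ray:
  assumes "x - w *\<^sub>R g \<in> fdom f"
  shows "DERIV (\<lambda>w. F (x - w *\<^sub>R g)) w :> - (g \<bullet> grad f (x - w *\<^sub>R g))"
proof -
  have "((\<lambda>w. x - w *\<^sub>R g) has_derivative (\<lambda>h. - (h *\<^sub>R g))) (at w)"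
    by (auto intro!: derivative_eq_intros)
  from has_derivative_compose[OF this F_has_derivative[OF assms]]
  have "((\<lambda>w. F (x - w *\<^sub>R g)) has_derivative (\<lambda>h. - (h *\<^sub>R g) \<bullet> grad f (x - w *\<^sub>R g))) (at w)" .
  then show ?thesis
    by (rule has_derivative_imp_has_field_derivative) simp
qed

lemma grad_has_derivative:
  "x \<in> fdom f \<Longrightarrow> (grad f has_derivative hess f x) (at x)"
  using smooth by (auto simp: l_smooth_def hess_def frechet_derivative_works[symmetric])

lemma onorm_hess_le: "x \<in> fdom f \<Longrightarrow> onorm (hess f x) \<le> l (norm (grad f x))"
  using smooth by (auto simp: l_smooth_def)

lemma continuous_on_grad: "continuous_on (fdom f) (grad f)"
  by (meson grad_has_derivative has_derivative_continuous continuous_at_imp_continuous_on)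

lemma l_pos: "0 \<le> s \<Longrightarrow> 0 < l s"
  using smooth by (auto simp: l_smooth_def)

lemma l_mono: "0 \<le> s \<Longrightarrow> s \<le> s' \<Longrightarrow> l s \<le> l s'"
  using smooth by (auto simp: l_smooth_def mono_on_def)

lemma continuous_on_l: "continuous_on {0..} l"
proof -
  have "continuous (at s within {0..}) l" if s: "0 \<le> s" for s
  proof -
    obtain u L where u: "u > 0" "L-lipschitz_on (cball s u \<inter> {0..}) l"
      using smooth s by (auto simp: l_smooth_def)
    have "continuous (at s within (cball s u \<inter> {0..})) l"
      using s u by (intro lipschitz_on_continuous_within[OF u(2)]) auto
    moreover have "at s within (cball s u \<inter> {0..}) = at s within {0..}"
      using u by (intro at_within_nhd[of _ "ball s u"]) auto
    ultimately show ?thesis by simp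
  qed
  then show ?thesis by (auto simp: continuous_on_eq_continuous_within)
qed

abbreviation r :: real where "r \<equiv> doubling_ratio l"

lemma l_double_le: "0 \<le> s \<Longrightarrow> l (2 * s) \<le> r * l s"
  using cSUP_upper[OF _ ratio_bdd, of s] l_pos[of s]
  by (auto simp: doubling_ratio_def divide_le_eq)

lemma r_pos: "0 < r"
  using cSUP_upper[OF _ ratio_bdd, of 0] l_pos[of 0] by (auto simp: doubling_ratio_def)

text \<open>The argument of \<open>l\<close> in the averaged step size runs from \<open>\<parallel>g\<parallel>\<close> to \<open>2 \<parallel>g\<parallel>\<close>.\<close>

lemma step_size_bounds:
  shows "1 / (5 * r * l (2 * norm g)) \<le> step_size l g"
    and "step_size l g \<le> 1 / (5 * r * l (norm g))"
proof -
  let ?s = "norm g" and ?u = "\<lambda>v. 1 / l (norm g + norm g * v)"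
  have "continuous_on {0..1} ?u"
    using l_pos by (intro continuous_intros continuous_on_compose2[OF continuous_on_l])
      (auto simp: less_imp_neq[symmetric])
  then have int: "?u integrable_on {0..1}" by (rule integrable_continuous_real)
  have u: "1 / l (2 * ?s) \<le> ?u v" "?u v \<le> 1 / l ?s" if "v \<in> {0..1}" for v
    using that l_pos[of "2 * ?s"] l_pos[of ?s] l_pos[of "?s + ?s * v"] mult_left_le[of v ?s]
    by (auto intro!: divide_left_mono l_mono mult_pos_pos)
  have "integral {0..1::real} (\<lambda>_. 1 / l (2 * ?s)) \<le> integral {0..1} ?u"
    by (rule integral_le[OF _ int u(1)]) auto
  then have "1 / l (2 * ?s) \<le> integral {0..1} ?u" by simp
  then have "1 / (5 * r) * (1 / l (2 * ?s)) \<le> step_size l g"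
    unfolding step_size_def using r_pos by (intro mult_left_mono) auto
  then show "1 / (5 * r * l (2 * norm g)) \<le> step_size l g" by simp
  have "integral {0..1} ?u \<le> integral {0..1::real} (\<lambda>_. 1 / l ?s)"
    by (rule integral_le[OF int _ u(2)]) auto
  then have "integral {0..1} ?u \<le> 1 / l ?s" by simp
  then have "step_size l g \<le> 1 / (5 * r) * (1 / l ?s)"
    unfolding step_size_def using r_pos by (intro mult_left_mono) auto
  then show "step_size l g \<le> 1 / (5 * r * l (norm g))" by simp
qed

text \<open>
  As long as the gradient stays below \<open>2 \<parallel>g\<parallel>\<close> on the way, the Hessian is bounded by
  \<open>l (2 \<parallel>g\<parallel>)\<close> there, and the mean value inequality applies on the segment covered so far.
\<close>

lemma grad_close_on_segment:
  assumes x: "x \<in> fdom f" and t: "0 \<le> t" "t \<le> h"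
    and good: "\<And>s. 0 \<le> s \<Longrightarrow> s \<le> t \<Longrightarrow> x - s *\<^sub>R g \<in> fdom f \<and> norm (grad f (x - s *\<^sub>R g)) < 2 * norm g"
    and h: "h * l (2 * norm g) \<le> 1 / 5"
  shows "norm (grad f (x - t *\<^sub>R g) - grad f x) \<le> norm g / 5"
proof -
  let ?S = "closed_segment x (x - t *\<^sub>R g)"
  have S: "z \<in> fdom f \<and> norm (grad f z) < 2 * norm g" if "z \<in> ?S" for z
  proof -
    from that obtain u where u: "0 \<le> u" "u \<le> 1" "z = x - (u * t) *\<^sub>R g"
      by (auto simp: closed_segment_def algebra_simps)
    then show ?thesis using good[of "u * t"] t by (simp add: mult_left_le_one_le)
  qed
  have "norm (grad f (x - t *\<^sub>R g) - grad f x) \<le> l (2 * norm g) * norm (x - t *\<^sub>R g - x)"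
  proof (rule differentiable_bound[of ?S _ "hess f"])
    fix z assume z: "z \<in> ?S"
    then show "(grad f has_derivative hess f z) (at z within ?S)"
      using S grad_has_derivative by (blast intro: has_derivative_at_withinI)
    show "onorm (hess f z) \<le> l (2 * norm g)"
      using S[OF z] onorm_hess_le[of z] l_mono[of "norm (grad f z)" "2 * norm g"] by simp
  qed auto
  also have "\<dots> = t * l (2 * norm g) * norm g" using t by simp
  also have "\<dots> \<le> h * l (2 * norm g) * norm g"
    using t l_pos[of "2 * norm g"] by (intro mult_right_mono) auto
  also have "\<dots> \<le> 1 / 5 * norm g" using h by (rule mult_right_mono) simp
  finally show ?thesis by simp
qed

text \<open>
  Let \<open>\<tau>\<close> be the first time at which the claim fails. Before \<open>\<tau>\<close> the gradient is at most
  \<open>4/3 \<parallel>g\<parallel> + 1/5 \<parallel>g\<parallel> = 23/15 \<parallel>g\<parallel>\<close>, so the objective stays bounded up to \<open>\<tau>\<close>. Continuity of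
  \<open>f\<close> on the closure of its domain makes the value at \<open>\<tau>\<close> finite, so the point at time \<open>\<tau>\<close> is in the
  domain. The gradient is continuous there and still at most \<open>23/15 \<parallel>g\<parallel> < 2 \<parallel>g\<parallel>\<close>, so the claim
  holds at \<open>\<tau>\<close> after all.
\<close>

lemma step_stays_in_domain:
  assumes x: "x \<in> fdom f" and g: "g \<noteq> 0" "norm (grad f x) \<le> 4 / 3 * norm g"
    and h: "h * l (2 * norm g) \<le> 1 / 5"
    and t: "0 \<le> t" "t \<le> h"
  shows "x - t *\<^sub>R g \<in> fdom f \<and> norm (grad f (x - t *\<^sub>R g)) < 2 * norm g"
proof (rule ccontr)
  assume bad: "\<not> ?thesis"
  define y where "y s = x - s *\<^sub>R g" for s
  define U where "U = {z \<in> fdom f. norm (grad f z) < 2 * norm g}"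
  have "open U"
  proof -
    have "U = fdom f \<inter> grad f -` {v. norm v < 2 * norm g}" by (auto simp: U_def)
    moreover have "open {v::'a. norm v < 2 * norm g}"
      by (intro open_Collect_less continuous_intros)
    ultimately show ?thesis
      using continuous_open_preimage[OF continuous_on_grad open_fdom] by metis
  qed
  have cont_y: "continuous_on S y" for S unfolding y_def by (intro continuous_intros)
  define N where "N = {0..h} - y -` U"
  have "compact N"
    unfolding N_def by (intro compact_diff compact_Icc open_vimage \<open>open U\<close> cont_y)
  moreover have "t \<in> N" using bad t by (auto simp: N_def U_def y_def)
  ultimately obtain \<tau> where \<tau>: "\<tau> \<in> N" and least: "\<And>s. s \<in> N \<Longrightarrow> \<tau> \<le> s"
    using compact_attains_inf[of N] by blast
  have gn: "0 < norm g" using g by simp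
  then have "norm (grad f x) < 2 * norm g" using g(2) by linarith
  with x have "y 0 \<in> U" by (simp add: y_def U_def)
  with \<tau> have \<tau>_pos: "0 < \<tau>" "\<tau> \<le> h" by (auto simp: N_def less_le)
  have before: "y s \<in> U" if "0 \<le> s" "s < \<tau>" for s
    using least[of s] that \<tau>_pos by (auto simp: N_def)
  have grad_bd: "norm (grad f (y s)) \<le> 23 / 15 * norm g" if "0 \<le> s" "s < \<tau>" for s
  proof -
    have "norm (grad f (x - s *\<^sub>R g) - grad f x) \<le> norm g / 5"
      using x that \<tau>_pos h before by (intro grad_close_on_segment[of x s h]) (auto simp: U_def y_def)
    then show ?thesis
      using norm_triangle_ineq2[of "grad f (y s)" "grad f x"] g by (simp add: y_def)
  qed
  have lim: "(y \<longlongrightarrow> y \<tau>) (at_left \<tau>)"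
    unfolding y_def by (intro tendsto_intros)
  have ev: "\<forall>\<^sub>F s in at_left \<tau>. 0 \<le> s \<and> s < \<tau>"
    using \<tau>_pos by (auto simp: eventually_at_left[OF \<tau>_pos(1)] intro!: exI[of _ 0])
  have ev_fdom: "\<forall>\<^sub>F s in at_left \<tau>. y s \<in> closure (fdom f)"
    using ev by eventually_elim (use before closure_subset[of "fdom f"] in \<open>auto simp: U_def\<close>)
  have F_bd: "F (y s) \<le> F x + 2 * norm g * norm g * h" if s: "0 \<le> s" "s < \<tau>" for s
  proof -
    have "\<exists>z. DERIV (\<lambda>w. F (y w) - 2 * norm g * norm g * w) w :> z \<and> z \<le> 0" if w: "0 \<le> w" "w \<le> s" for w
    proof -
      have yw: "y w \<in> fdom f" "norm (grad f (y w)) < 2 * norm g"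
        using before[of w] w s by (auto simp: U_def)
      have "DERIV (\<lambda>w. F (y w)) w :> - (g \<bullet> grad f (y w))"
        using DERIV_F_along_ray yw(1) unfolding y_def by blast
      then have "DERIV (\<lambda>w. F (y w) - 2 * norm g * norm g * w) w :> - (g \<bullet> grad f (y w)) - 2 * norm g * norm g"
        by (auto intro!: derivative_eq_intros)
      moreover have "- (g \<bullet> grad f (y w)) \<le> norm g * norm (grad f (y w))"
        using Cauchy_Schwarz_ineq2[of g "grad f (y w)"] by linarith
      moreover have "norm g * norm (grad f (y w)) \<le> norm g * (2 * norm g)"
        using yw by (intro mult_left_mono) auto
      ultimately show ?thesis by (intro exI conjI) auto
    qed
    from DERIV_nonpos_imp_nonincreasing[OF s(1) this]
    have "F (y s) \<le> F x + 2 * norm g * norm g * s" by (simp add: y_def)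
    also have "2 * norm g * norm g * s \<le> 2 * norm g * norm g * h"
      using s \<tau>_pos by (intro mult_left_mono) auto
    finally show ?thesis by simp
  qed
  have y_\<tau>: "y \<tau> \<in> fdom f"
  proof -
    have "y \<tau> \<in> closure (fdom f)"
      using Lim_in_closed_set[OF closed_closure ev_fdom _ lim] by simp
    then have "((\<lambda>s. f (y s)) \<longlongrightarrow> f (y \<tau>)) (at_left \<tau>)"
      using smooth lim ev_fdom
      by (intro continuous_on_tendsto_compose[of "closure (fdom f)" f]) (auto simp: l_smooth_def)
    moreover have "\<forall>\<^sub>F s in at_left \<tau>. f (y s) \<le> ereal (F x + 2 * norm g * norm g * h)"
      using ev
    proof eventually_elim
      case (elim s)
      then have "y s \<in> fdom f" using before by (auto simp: U_def)
      then show ?case using F_bd[of s] elim by (subst f_eq_ereal_F) auto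
    qed
    ultimately have "f (y \<tau>) \<le> ereal (F x + 2 * norm g * norm g * h)"
      by (rule tendsto_upperbound) simp
    then show ?thesis by (auto simp: fdom_def)
  qed
  have "((\<lambda>s. grad f (y s)) \<longlongrightarrow> grad f (y \<tau>)) (at_left \<tau>)"
    using y_\<tau> grad_has_derivative lim
    by (intro isCont_tendsto_compose[of _ "grad f"]) (auto dest: has_derivative_continuous)
  then have "norm (grad f (y \<tau>)) \<le> 23 / 15 * norm g"
    by (rule tendsto_upperbound[OF tendsto_norm]) (use ev grad_bd in \<open>auto elim: eventually_mono\<close>)
  with gn have "norm (grad f (y \<tau>)) < 2 * norm g" by linarith
  with y_\<tau> have "y \<tau> \<in> U" by (simp add: U_def)
  with \<tau> show False by (simp add: N_def)
qed

text \<open>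
  The relative error \<open>1/4\<close> puts \<open>\<parallel>g\<parallel>\<close> between \<open>3/4 a\<close> and \<open>5/4 a\<close>, where \<open>a\<close> is the gradient norm.
  Since the gradient changes by at most \<open>\<parallel>g\<parallel>/5\<close>, the objective decreases along \<open>-g\<close> at a rate of at
  least \<open>3/4 a\<^sup>2 - 1/5 (5/4 a)\<^sup>2\<close>, which exceeds \<open>a\<^sup>2/4\<close>. The step size is at least
  \<open>1 / (5 r l(2 \<parallel>g\<parallel>))\<close>, and \<open>2 \<parallel>g\<parallel> \<le> 3 a\<close>.
\<close>

lemma descent_step:
  assumes x: "x \<in> fdom f" and nz: "grad f x \<noteq> 0"
    and err: "norm (g - grad f x) \<le> norm (grad f x) / 4"
  shows "x - step_size l g *\<^sub>R g \<in> fdom f"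
    and "F (x - step_size l g *\<^sub>R g) \<le> F x - (norm (grad f x))\<^sup>2 / (20 * r * l (3 * norm (grad f x)))"
proof -
  define a h where "a = norm (grad f x)" and "h = step_size l g"
  have a: "a > 0" using nz by (simp add: a_def)
  have g: "3 / 4 * a \<le> norm g" "norm g \<le> 5 / 4 * a"
    using err norm_triangle_ineq2[of "grad f x" g] norm_triangle_ineq2[of g "grad f x"]
    by (auto simp: a_def norm_minus_commute)
  have gn: "norm g > 0" "g \<noteq> 0" using g(1) a by auto
  have h0: "0 < h"
    using step_size_bounds(1)[of g] r_pos l_pos[of "2 * norm g"] unfolding h_def
    by (intro less_le_trans[OF _ step_size_bounds(1)]) simp
  have h: "h * l (2 * norm g) \<le> 1 / 5"
  proof -
    have "h * l (2 * norm g) \<le> 1 / (5 * r * l (norm g)) * (r * l (norm g))"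
      using step_size_bounds(2)[of g] l_double_le[of "norm g"] l_pos[of "2 * norm g"] r_pos l_pos[of "norm g"] h0
      unfolding h_def by (intro mult_mono) auto
    also have "\<dots> = 1 / 5" using r_pos l_pos[of "norm g"] by (simp add: field_simps)
    finally show ?thesis .
  qed
  have dom: "x - t *\<^sub>R g \<in> fdom f \<and> norm (grad f (x - t *\<^sub>R g)) < 2 * norm g" if "0 \<le> t" "t \<le> h" for t
    using step_stays_in_domain[OF x gn(2) _ h that] g(1) by (simp add: a_def)
  from dom[of h] h0 show "x - step_size l g *\<^sub>R g \<in> fdom f" by (simp add: h_def)
  have near: "norm (grad f (x - t *\<^sub>R g) - grad f x) \<le> norm g / 5" if "0 \<le> t" "t \<le> h" for t
    using grad_close_on_segment[OF x that _ h] dom that by simp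
  define c where "c = g \<bullet> grad f x - norm g * norm g / 5"
  have "\<exists>z. DERIV (\<lambda>w. F (x - w *\<^sub>R g) + c * w) w :> z \<and> z \<le> 0" if w: "0 \<le> w" "w \<le> h" for w
  proof -
    have "DERIV (\<lambda>w. F (x - w *\<^sub>R g)) w :> - (g \<bullet> grad f (x - w *\<^sub>R g))"
      using DERIV_F_along_ray dom[OF w] by blast
    then have "DERIV (\<lambda>w. F (x - w *\<^sub>R g) + c * w) w :> - (g \<bullet> grad f (x - w *\<^sub>R g)) + c"
      by (auto intro!: derivative_eq_intros)
    moreover have "- (g \<bullet> (grad f (x - w *\<^sub>R g) - grad f x)) \<le> norm g * norm (grad f (x - w *\<^sub>R g) - grad f x)"
      using Cauchy_Schwarz_ineq2[of g "grad f (x - w *\<^sub>R g) - grad f x"] by linarith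
    moreover have "norm g * norm (grad f (x - w *\<^sub>R g) - grad f x) \<le> norm g * (norm g / 5)"
      using near[OF w] by (intro mult_left_mono) auto
    ultimately show ?thesis by (intro exI conjI) (auto simp: c_def inner_diff_right)
  qed
  from DERIV_nonpos_imp_nonincreasing[OF less_imp_le[OF h0] this]
  have dec: "F (x - h *\<^sub>R g) \<le> F x - h * c" by (simp add: mult.commute)
  have c: "c \<ge> a\<^sup>2 / 4"
  proof -
    have "(g - grad f x) \<bullet> grad f x \<ge> - (norm (g - grad f x) * a)"
      using Cauchy_Schwarz_ineq2[of "g - grad f x" "grad f x"] unfolding a_def by linarith
    moreover have "norm (g - grad f x) * a \<le> a / 4 * a"
      using err a unfolding a_def by (intro mult_right_mono) auto
    moreover have "norm g * norm g \<le> (5 / 4 * a) * (5 / 4 * a)" using g a by (intro mult_mono) auto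
    moreover have "grad f x \<bullet> grad f x = a * a"
      by (simp add: a_def power2_norm_eq_inner[symmetric] power2_eq_square)
    moreover have "0 \<le> a * a" by simp
    ultimately show ?thesis unfolding c_def inner_diff_left power2_eq_square by linarith
  qed
  have "0 \<le> c" using c zero_le_power2[of a] by linarith
  have "a\<^sup>2 / (20 * r * l (3 * a)) = 1 / (5 * r * l (3 * a)) * (a\<^sup>2 / 4)" by simp
  also have "\<dots> \<le> 1 / (5 * r * l (2 * norm g)) * c"
    using c g a l_mono[of "2 * norm g" "3 * a"] l_pos[of "2 * norm g"] l_pos[of "3 * a"] r_pos
    by (intro mult_mono divide_left_mono) auto
  also have "\<dots> \<le> h * c"
    using step_size_bounds(1)[of g] \<open>0 \<le> c\<close> unfolding h_def by (intro mult_right_mono) auto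
  finally show "F (x - step_size l g *\<^sub>R g) \<le> F x - (norm (grad f x))\<^sup>2 / (20 * r * l (3 * norm (grad f x)))"
    using dec by (simp add: a_def h_def)
qed

text \<open>Every term of the telescoping sum is at least the minimum, scaled by \<open>9/4 * 20 = 45\<close>.\<close>

lemma min_gradient_bound:
  fixes x :: "nat \<Rightarrow> 'a"
  assumes T: "T > 0"
    and low: "fstar \<le> F (x T)"
    and dec: "\<And>k. k < T \<Longrightarrow> F (x (Suc k)) \<le> F (x k) - (norm (grad f (x k)))\<^sup>2 / (20 * r * l (3 * norm (grad f (x k))))"
  shows "(MIN k\<in>{..<T}. (3 / 2 * norm (grad f (x k)))\<^sup>2 / l (3 * norm (grad f (x k))))
            \<le> r * (45 * (F (x 0) - fstar) / real T)" (is "?m \<le> _")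
proof -
  have "(\<Sum>k<T. ?m / (45 * r)) \<le> (\<Sum>k<T. F (x k) - F (x (Suc k)))"
  proof (rule sum_mono)
    fix k assume k: "k \<in> {..<T}"
    let ?a = "norm (grad f (x k))"
    have "?m \<le> (3 / 2 * ?a)\<^sup>2 / l (3 * ?a)" using k by (intro Min_le) auto
    then have "?m / (45 * r) \<le> (3 / 2 * ?a)\<^sup>2 / l (3 * ?a) / (45 * r)"
      using r_pos by (intro divide_right_mono) auto
    also have "\<dots> = ?a\<^sup>2 / (20 * r * l (3 * ?a))" by (simp add: power_mult_distrib power_divide)
    also have "\<dots> \<le> F (x k) - F (x (Suc k))" using dec k by (simp add: algebra_simps)
    finally show "?m / (45 * r) \<le> F (x k) - F (x (Suc k))" .
  qed
  also have "\<dots> = F (x 0) - F (x T)" by (rule sum_lessThan_telescope')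
  also have "\<dots> \<le> F (x 0) - fstar" using low by simp
  finally have "real T * ?m \<le> 45 * r * (F (x 0) - fstar)"
    using r_pos by (simp add: field_simps)
  then show ?thesis using T by (simp add: field_simps)
qed

text \<open>
  As a function of \<open>\<parallel>g\<parallel>\<close> the step size is antitone. The truncation \<open>max 0\<close> turns it into an antitone
  function on all reals, to which measurability of monotone functions applies.
\<close>

lemma borel_measurable_step_size: "step_size l \<in> borel_measurable (borel :: 'a measure)"
proof -
  define I where "I s = integral {0..1} (\<lambda>v. 1 / l (max 0 s + max 0 s * v))" for s
  have "mono (\<lambda>s. - I s)"
  proof (rule monoI)
    fix s s' :: real assume "s \<le> s'"
    have "(\<lambda>v. 1 / l (max 0 s + max 0 s * v)) integrable_on {0..1}" for s
      using l_pos by (intro integrable_continuous_real continuous_intros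
          continuous_on_compose2[OF continuous_on_l]) (auto simp: less_imp_neq[symmetric])
    then have "I s' \<le> I s"
      unfolding I_def using \<open>s \<le> s'\<close>
      by (intro integral_le divide_left_mono l_mono mult_pos_pos l_pos)
        (auto intro!: add_mono mult_right_mono add_nonneg_nonneg)
    then show "- I s \<le> - I s'" by simp
  qed
  then have "(\<lambda>s. - (- I s)) \<in> borel_measurable borel"
    by (intro borel_measurable_uminus borel_measurable_mono)
  then have [measurable]: "I \<in> borel_measurable borel" by simp
  have "step_size l = (\<lambda>g::'a. 1 / (5 * r) * I (norm g))" 
    by (simp add: fun_eq_iff step_size_def I_def)
  then show ?thesis by simp
qed

end

section \<open>Iterates frozen outside the domain\<close>

lemma sgd_point_0 [simp]: "sgd_point l G B x\<^sub>0 z 0 = x\<^sub>0"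
  by (simp add: sgd_point_def)

definition batch_mean :: "('a::euclidean_space \<Rightarrow> 'z \<Rightarrow> 'a) \<Rightarrow> nat \<Rightarrow> 'a \<Rightarrow> (nat \<Rightarrow> 'z) \<Rightarrow> 'a"
  where "batch_mean G B y z = (1 / real B) *\<^sub>R (\<Sum>j\<in>{1..B}. G y (z j))"

lemma sgd_point_Suc:
  "sgd_point l G B x\<^sub>0 z (Suc k) = sgd_point l G B x\<^sub>0 z k -
     step_size l (batch_mean G B (sgd_point l G B x\<^sub>0 z k) (z k)) *\<^sub>R
     batch_mean G B (sgd_point l G B x\<^sub>0 z k) (z k)"
  by (simp add: sgd_point_def batch_mean_def split_beta Let_def interv_sum_list_conv_sum_set_nat
      atLeastLessThanSuc_atLeastAtMost del: upt_Suc)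

lemma length_sgd_computed: "length (sgd_computed l G B x\<^sub>0 z k) = B * k"
  by (induction k) (simp_all add: sgd_computed_def split_beta Let_def del: upt_Suc)

lemma sgd_point_cong:
  assumes "\<And>i j. i < k \<Longrightarrow> j \<in> {1..B} \<Longrightarrow> z i j = z' i j"
  shows "sgd_point l G B x\<^sub>0 z k = sgd_point l G B x\<^sub>0 z' k"
  using assms
proof (induction k)
  case (Suc k)
  then have "sgd_point l G B x\<^sub>0 z k = sgd_point l G B x\<^sub>0 z' k" by simp
  moreover have "batch_mean G B y (z k) = batch_mean G B y (z' k)" for y
    unfolding batch_mean_def using Suc.prems by (intro arg_cong[where f = "scaleR _"] sum.cong) auto
  ultimately show ?case by (simp add: sgd_point_Suc)
qed simp

text \<open>
  Outside the domain neither measurability nor meaning of the stochastic gradients is guaranteed.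
  Replacing them by zero there freezes the iteration at the first iterate outside \<open>S\<close>. The frozen
  iteration is measurable, and its \<open>k\<close>-th iterate lies in \<open>S\<close> exactly if all original iterates up to
  \<open>k\<close> do.
\<close>

definition stopped :: "'a set \<Rightarrow> ('a::zero \<Rightarrow> 'z \<Rightarrow> 'a) \<Rightarrow> 'a \<Rightarrow> 'z \<Rightarrow> 'a"
  where "stopped S G y z = (if y \<in> S then G y z else 0)"

lemma sgd_point_stopped_Suc_outside:
  "sgd_point l (stopped S G) B x\<^sub>0 z k \<notin> S \<Longrightarrow>
   sgd_point l (stopped S G) B x\<^sub>0 z (Suc k) = sgd_point l (stopped S G) B x\<^sub>0 z k"
  by (simp add: sgd_point_Suc batch_mean_def stopped_def)

lemma sgd_point_stopped_eq:
  "(\<And>i. i < k \<Longrightarrow> sgd_point l G B x\<^sub>0 z i \<in> S) \<Longrightarrow>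
   sgd_point l (stopped S G) B x\<^sub>0 z k = sgd_point l G B x\<^sub>0 z k"
  by (induction k) (simp_all add: sgd_point_Suc batch_mean_def stopped_def)

lemma sgd_point_stopped_in_iff:
  "sgd_point l (stopped S G) B x\<^sub>0 z k \<in> S \<longleftrightarrow> (\<forall>i\<le>k. sgd_point l G B x\<^sub>0 z i \<in> S)"
proof (induction k)
  case (Suc k)
  show ?case
  proof (cases "\<forall>i\<le>k. sgd_point l G B x\<^sub>0 z i \<in> S")
    case True
    then show ?thesis
      using sgd_point_stopped_eq[of "Suc k" l G B x\<^sub>0 z S] by (auto simp: le_Suc_eq less_Suc_eq_le)
  next
    case False
    then show ?thesis
      using Suc sgd_point_stopped_Suc_outside[of l S G B x\<^sub>0 z k] by (auto simp: le_Suc_eq)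
  qed
qed simp

lemma measurable_stopped:
  fixes S :: "'a::euclidean_space set"
  assumes S: "S \<in> sets borel"
    and G: "(\<lambda>(y, z). G y z) \<in> borel_measurable (restrict_space borel S \<Otimes>\<^sub>M D)"
  shows "(\<lambda>p. stopped S G (fst p) (snd p)) \<in> borel_measurable (borel \<Otimes>\<^sub>M D)"
proof -
  have "(\<lambda>p. if p \<in> S \<times> space D then (case p of (y, z) \<Rightarrow> G y z) else 0) \<in> borel_measurable (borel \<Otimes>\<^sub>M D)"
  proof (subst measurable_restrict_space_iff[symmetric])
    have "(\<lambda>p. (fst p, snd p)) \<in> measurable (restrict_space (borel \<Otimes>\<^sub>M D) (S \<times> space D)) (restrict_space borel S \<Otimes>\<^sub>M D)"
      by (intro measurable_Pair measurable_restrict_space2 measurable_restrict_space1)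
        (auto simp: space_restrict_space)
    from measurable_compose[OF this G]
    show "(\<lambda>(y, z). G y z) \<in> borel_measurable (restrict_space (borel \<Otimes>\<^sub>M D) (S \<times> space D))"
      by (simp add: split_beta')
  qed (use S in \<open>auto simp: space_pair_measure\<close>)
  then show ?thesis
    by (rule measurable_cong[THEN iffD1, rotated]) (auto simp: stopped_def space_pair_measure)
qed

lemma measurable_sgd_point:
  fixes G :: "'a::euclidean_space \<Rightarrow> 'z \<Rightarrow> 'a"
  assumes G: "(\<lambda>p. G (fst p) (snd p)) \<in> borel_measurable (borel \<Otimes>\<^sub>M D)"
    and step: "step_size l \<in> borel_measurable (borel :: 'a measure)"
    and z: "\<And>i j. i < k \<Longrightarrow> j \<in> {1..B} \<Longrightarrow> (\<lambda>\<omega>. z \<omega> i j) \<in> measurable N D"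
  shows "(\<lambda>\<omega>. sgd_point l G B x\<^sub>0 (z \<omega>) k) \<in> borel_measurable N"
  using z
proof (induction k)
  case (Suc k)
  have IH[measurable]: "(\<lambda>\<omega>. sgd_point l G B x\<^sub>0 (z \<omega>) k) \<in> borel_measurable N"
    using Suc by simp
  have [measurable]: "(\<lambda>\<omega>. G (sgd_point l G B x\<^sub>0 (z \<omega>) k) (z \<omega> k j)) \<in> borel_measurable N"
    if "j \<in> {1..B}" for j
    using measurable_compose[OF measurable_Pair[OF IH Suc.prems[OF lessI that]] G] by simp
  have [measurable]: "(\<lambda>\<omega>. batch_mean G B (sgd_point l G B x\<^sub>0 (z \<omega>) k) (z \<omega> k)) \<in> borel_measurable N"
    unfolding batch_mean_def by (intro borel_measurable_scaleR borel_measurable_const borel_measurable_sum) auto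
  note step[measurable]
  show ?case unfolding sgd_point_Suc by measurable
qed simp

section \<open>The probability of a bad batch\<close>

locale light_tailed_oracle = generalized_smooth f l + D: prob_space D
  for f :: "'a::euclidean_space \<Rightarrow> ereal" and l :: "real \<Rightarrow> real" and D :: "'z measure" +
  fixes G :: "'a \<Rightarrow> 'z \<Rightarrow> 'a" and \<sigma> :: real
  assumes G_measurable: "(\<lambda>(y, z). G y z) \<in> borel_measurable (restrict_space borel (fdom f) \<Otimes>\<^sub>M D)"
    and \<sigma>_pos: "\<sigma> > 0"
    and unbiased: "\<And>y. y \<in> fdom f \<Longrightarrow> (\<integral>z. G y z \<partial>D) = grad f y"
    and light_tail: "\<And>y. y \<in> fdom f \<Longrightarrow>
          (\<integral>\<^sup>+z. ennreal (exp ((norm (G y z - grad f y))\<^sup>2 / \<sigma>\<^sup>2)) \<partial>D) \<le> ennreal (exp 1)"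
begin

abbreviation G' :: "'a \<Rightarrow> 'z \<Rightarrow> 'a" where "G' \<equiv> stopped (fdom f) G"

lemma fdom_borel [measurable]: "fdom f \<in> sets borel"
  using open_fdom by simp

lemma measurable_G': "(\<lambda>p. G' (fst p) (snd p)) \<in> borel_measurable (borel \<Otimes>\<^sub>M D)"
  by (rule measurable_stopped[OF fdom_borel G_measurable])

definition grad0 :: "'a \<Rightarrow> 'a" where "grad0 y = (if y \<in> fdom f then grad f y else 0)"

lemma measurable_grad0 [measurable]: "grad0 \<in> borel_measurable borel"
proof -
  have "grad f \<in> borel_measurable (restrict_space borel (fdom f))"
    by (rule borel_measurable_continuous_on_restrict[OF continuous_on_grad])
  then show ?thesis
    unfolding grad0_def[abs_def] by (subst (asm) measurable_restrict_space_iff) auto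
qed

lemma centered_oracle:
  assumes y: "y \<in> fdom f"
  shows "(\<lambda>z. G y z - grad f y) \<in> borel_measurable D" "(\<integral>z. (G y z - grad f y) \<partial>D) = 0"
proof -
  have "(\<lambda>z. G' y z) \<in> borel_measurable D"
    using measurable_compose[OF measurable_Pair1' measurable_G', of y] by simp
  with y have G: "(\<lambda>z. G y z) \<in> borel_measurable D" by (simp add: stopped_def)
  then show meas: "(\<lambda>z. G y z - grad f y) \<in> borel_measurable D" by simp
  have "integrable D (\<lambda>z. (1 / \<sigma>) *\<^sub>R (G y z - grad f y))"
    using light_tail[OF y] meas \<sigma>_pos
    by (intro light_tail_integrable_exp(3)) (auto simp: power_divide)
  from integrable_scaleR_right[OF this, of \<sigma>] have "integrable D (\<lambda>z. G y z - grad f y)"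
    using \<sigma>_pos by simp
  from Bochner_Integration.integrable_add[OF this, of "\<lambda>_. grad f y"]
  have "integrable D (G y)" by simp
  then show "(\<integral>z. (G y z - grad f y) \<partial>D) = 0"
    using unbiased[OF y] by (simp add: D.prob_space)
qed

text \<open>
  The batch size turns the deviation \<open>sqrt 2 (1 + b) \<sigma> sqrt B\<close> of the sum into a deviation of at most
  \<open>sqrt \<epsilon> / 4\<close> of the mean, because \<open>sqrt 2 * 4 = sqrt 32\<close>.
\<close>

lemma batch_mean_tail:
  assumes y: "y \<in> fdom f" and B: "B \<ge> 1" and b: "0 \<le> b"
    and large: "32 * (1 + b)\<^sup>2 * \<sigma>\<^sup>2 / \<epsilon> \<le> real B" and \<epsilon>: "\<epsilon> > 0"
  shows "emeasure (PiM ({k::nat} \<times> {1..B}) (\<lambda>_. D)) {q \<in> space (PiM ({k} \<times> {1..B}) (\<lambda>_. D)).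
      sqrt \<epsilon> / 4 \<le> norm (batch_mean G B y (\<lambda>j. q (k, j)) - grad f y)} \<le> ennreal (exp (- b\<^sup>2 / 3))"
    (is "emeasure ?P ?E \<le> _")
proof -
  define X where "X z = G y z - grad f y" for z
  note [measurable] = centered_oracle(1)[OF y, folded X_def]
  let ?J = "{k} \<times> {1..B}"
  let ?E' = "{q \<in> space ?P. sqrt 2 * (1 + b) * \<sigma> * sqrt (real (card ?J)) \<le> norm (\<Sum>j\<in>?J. X (q j))}"
  have card: "card ?J = B" by (simp add: card_cartesian_product)
  have "emeasure ?P ?E \<le> emeasure ?P ?E'"
  proof (rule emeasure_mono)
    show "?E \<subseteq> ?E'"
    proof safe
      fix q assume q: "sqrt \<epsilon> / 4 \<le> norm (batch_mean G B y (\<lambda>j. q (k, j)) - grad f y)"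
      have "batch_mean G B y (\<lambda>j. q (k, j)) - grad f y = (1 / real B) *\<^sub>R (\<Sum>j\<in>{1..B}. X (q (k, j)))"
        using B by (simp add: batch_mean_def X_def sum_subtractf scaleR_diff_right sum_constant_scaleR)
      also have "(\<Sum>j\<in>{1..B}. X (q (k, j))) = (\<Sum>j\<in>?J. X (q j))"
        by (rule sum.reindex_bij_witness[of _ snd "Pair k"]) auto
      finally have "real B * (sqrt \<epsilon> / 4) \<le> norm (\<Sum>j\<in>?J. X (q j))"
        using q B by (simp add: field_simps)
      moreover have "sqrt 2 * (1 + b) * \<sigma> * sqrt (real B) \<le> real B * (sqrt \<epsilon> / 4)"
      proof -
        have "(1 + b)\<^sup>2 * \<sigma>\<^sup>2 * 2 * 16 \<le> real B * \<epsilon>" using large \<epsilon> by (simp add: field_simps)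
        then have "((1 + b) * \<sigma> * 4)\<^sup>2 * 2 \<le> real B * \<epsilon>"
          by (simp add: power_mult_distrib)
        then have "sqrt (((1 + b) * \<sigma> * 4)\<^sup>2) * sqrt 2 \<le> sqrt (real B) * sqrt \<epsilon>"
          unfolding real_sqrt_mult[symmetric] by (rule real_sqrt_le_mono)
        then have "(1 + b) * \<sigma> * 4 * sqrt 2 \<le> sqrt (real B) * sqrt \<epsilon>"
          using b \<sigma>_pos unfolding real_sqrt_abs by (simp add: abs_mult)
        then have "(1 + b) * \<sigma> * 4 * sqrt 2 * sqrt (real B) \<le> sqrt (real B) * sqrt \<epsilon> * sqrt (real B)"
          by (rule mult_right_mono) simp
        also have "\<dots> = real B * sqrt \<epsilon>" by (simp add: mult_ac flip: mult.assoc)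
        finally show ?thesis by (simp add: algebra_simps)
      qed
      ultimately show "sqrt 2 * (1 + b) * \<sigma> * sqrt (real (card ?J)) \<le> norm (\<Sum>j\<in>?J. X (q j))"
        by (simp add: card)
    qed
  qed measurable
  also have "\<dots> \<le> ennreal (exp (- b\<^sup>2 / 3))"
    using centered_oracle[OF y] light_tail[OF y] b \<sigma>_pos B D.prob_space_axioms
    by (intro sum_iid_light_tail) (auto simp: X_def)
  finally show ?thesis .
qed

text \<open>
  The \<open>k\<close>-th iterate is a function of the samples of earlier iterations, which are independent
  of the \<open>k\<close>-th batch. By Fubini it may be held fixed while integrating over the batch, and the tail
  bound for a fixed point applies. The event requires the frozen iterate to be in the domain, since
  the oracle is controlled only there.
\<close>

lemma bad_batch_prob:
  fixes M :: "'w measure" and \<xi> :: "nat \<Rightarrow> nat \<Rightarrow> 'w \<Rightarrow> 'z" and x\<^sub>0 :: 'a and k :: nat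
  assumes M: "prob_space M"
    and indep: "prob_space.indep_vars M (\<lambda>_. D) (\<lambda>(k, j). \<xi> k j) (UNIV \<times> {1..B})"
    and copies: "\<And>k j. j \<in> {1..B} \<Longrightarrow> distr M D (\<xi> k j) = D"
    and B: "B \<ge> 1" and b: "0 \<le> b"
    and large: "32 * (1 + b)\<^sup>2 * \<sigma>\<^sup>2 / \<epsilon> \<le> real B" and \<epsilon>: "\<epsilon> > 0"
  defines "Y \<equiv> \<lambda>\<omega>. sgd_point l G' B x\<^sub>0 (\<lambda>i j. \<xi> i j \<omega>) k"
  defines "bad \<equiv> {\<omega> \<in> space M. Y \<omega> \<in> fdom f \<and>
        sqrt \<epsilon> / 4 \<le> norm (batch_mean G B (Y \<omega>) (\<lambda>j. \<xi> k j \<omega>) - grad f (Y \<omega>))}"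
  shows "bad \<in> sets M" and "measure M bad \<le> exp (- b\<^sup>2 / 3)"
proof -
  interpret M: prob_space M by fact
  let ?I = "{..<k} \<times> {1..B}" and ?J = "{k} \<times> {1..B}" and ?\<xi> = "\<lambda>(k, j). \<xi> k j"
  let ?PI = "PiM ?I (\<lambda>_. D)" and ?PJ = "PiM ?J (\<lambda>_. D)"
  define past where "past \<omega> = restrict (\<lambda>p. ?\<xi> p \<omega>) ?I" for \<omega>
  define now where "now \<omega> = restrict (\<lambda>p. ?\<xi> p \<omega>) ?J" for \<omega>
  define Z where "Z p = sgd_point l G' B x\<^sub>0 (\<lambda>i j. p (i, j)) k" for p
  have Z[measurable]: "Z \<in> borel_measurable ?PI"
    unfolding Z_def
    by (intro measurable_sgd_point[OF measurable_G' borel_measurable_step_size] measurable_component_singleton) auto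
  have Y_eq: "Y \<omega> = Z (past \<omega>)" for \<omega>
    unfolding Y_def Z_def by (intro sgd_point_cong) (auto simp: past_def)
  define E where "E = {pq \<in> space (?PI \<Otimes>\<^sub>M ?PJ). Z (fst pq) \<in> fdom f \<and>
     sqrt \<epsilon> / 4 \<le> norm (batch_mean G' B (Z (fst pq)) (\<lambda>j. snd pq (k, j)) - grad0 (Z (fst pq)))}"
  have [measurable]: "(\<lambda>pq. batch_mean G' B (Z (fst pq)) (\<lambda>j. snd pq (k, j))) \<in> borel_measurable (?PI \<Otimes>\<^sub>M ?PJ)"
  proof -
    have "(\<lambda>pq. G' (Z (fst pq)) (snd pq (k, j))) \<in> borel_measurable (?PI \<Otimes>\<^sub>M ?PJ)" if "j \<in> {1..B}" for j
    proof -
      have "(\<lambda>pq. (Z (fst pq), snd pq (k, j))) \<in> measurable (?PI \<Otimes>\<^sub>M ?PJ) (borel \<Otimes>\<^sub>M D)"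
        using that by (intro measurable_Pair measurable_compose[OF measurable_fst Z]
            measurable_compose[OF measurable_snd measurable_component_singleton]) auto
      from measurable_compose[OF this measurable_G'] show ?thesis by simp
    qed
    then show ?thesis
      unfolding batch_mean_def
      by (intro borel_measurable_scaleR borel_measurable_const borel_measurable_sum) auto
  qed
  have E[measurable]: "E \<in> sets (?PI \<Otimes>\<^sub>M ?PJ)" unfolding E_def by measurable
  have ind: "M.indep_var ?PI past ?PJ now"
    unfolding past_def[abs_def] now_def[abs_def]
    by (rule M.indep_var_restrict[OF indep]) auto
  note rv = M.indep_var_rv1[OF ind] M.indep_var_rv2[OF ind]
  have pair[measurable]: "(\<lambda>\<omega>. (past \<omega>, now \<omega>)) \<in> measurable M (?PI \<Otimes>\<^sub>M ?PJ)"
    using rv by simp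
  have bad_eq: "bad = (\<lambda>\<omega>. (past \<omega>, now \<omega>)) -` E \<inter> space M"
  proof -
    have "batch_mean G B y (\<lambda>j. \<xi> k j \<omega>) = batch_mean G' B y (\<lambda>j. now \<omega> (k, j))" if "y \<in> fdom f" for y \<omega>
      using that by (simp add: batch_mean_def stopped_def now_def)
    then show ?thesis
      using measurable_space[OF pair] by (auto simp: E_def Y_eq grad0_def bad_def)
  qed
  then show "bad \<in> sets M" using measurable_sets[OF pair E] by simp
  have now_distr: "distr M ?PJ now = ?PJ"
  proof -
    have "M.indep_vars (\<lambda>_. D) ?\<xi> ?J" by (rule M.indep_vars_subset[OF indep]) auto
    moreover have "M.random_variable D (?\<xi> p)" if "p \<in> ?J" for p
      using indep that by (auto simp: M.indep_vars_def)
    ultimately have "distr M ?PJ now = PiM ?J (\<lambda>p. distr M D (?\<xi> p))"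
      using M.indep_vars_iff_distr_eq_PiM'[of ?J ?\<xi> "\<lambda>_. D"] B
      by (auto simp: now_def[abs_def])
    also have "\<dots> = ?PJ" using copies by (intro PiM_cong) auto
    finally show ?thesis .
  qed
  interpret PJ: prob_space ?PJ by (intro prob_space_PiM D.prob_space_axioms)
  interpret past: prob_space "distr M ?PI past" by (rule M.prob_space_distr[OF rv(1)])
  have "emeasure M bad = emeasure (distr M (?PI \<Otimes>\<^sub>M ?PJ) (\<lambda>\<omega>. (past \<omega>, now \<omega>))) E"
    unfolding bad_eq by (rule emeasure_distr[OF pair E, symmetric])
  also have "\<dots> = emeasure (distr M ?PI past \<Otimes>\<^sub>M ?PJ) E"
    using ind now_distr by (simp add: M.indep_var_distribution_eq)
  also have "\<dots> = (\<integral>\<^sup>+p. emeasure ?PJ (Pair p -` E) \<partial>distr M ?PI past)"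
    by (rule PJ.emeasure_pair_measure_alt)
      (use E in \<open>simp cong: sets_pair_measure_cong\<close>)
  also have "\<dots> \<le> (\<integral>\<^sup>+p. ennreal (exp (- b\<^sup>2 / 3)) \<partial>distr M ?PI past)"
  proof (rule nn_integral_mono)
    fix p
    show "emeasure ?PJ (Pair p -` E) \<le> ennreal (exp (- b\<^sup>2 / 3))"
    proof (cases "p \<in> space ?PI \<and> Z p \<in> fdom f")
      case True
      then have "Pair p -` E = {q \<in> space ?PJ. sqrt \<epsilon> / 4 \<le> norm (batch_mean G B (Z p) (\<lambda>j. q (k, j)) - grad f (Z p))}"
        by (auto simp: E_def space_pair_measure grad0_def batch_mean_def stopped_def)
      then show ?thesis using batch_mean_tail[of "Z p" B b \<epsilon> k] True B b large \<epsilon> by metis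
    next
      case False
      then have "Pair p -` E = {}" by (auto simp: E_def space_pair_measure)
      then show ?thesis by simp
    qed
  qed
  also have "\<dots> = ennreal (exp (- b\<^sup>2 / 3))" using past.emeasure_space_1 by simp
  finally show "measure M bad \<le> exp (- b\<^sup>2 / 3)"
    by (simp add: M.emeasure_eq_measure)
qed

end
section \<open>The high-probability complexity bound\<close>

theorem theorem9p2:
  fixes f :: "'a::euclidean_space \<Rightarrow> ereal"
    and l :: "real \<Rightarrow> real"
    and fstar \<sigma> \<epsilon> \<delta> \<Delta> r :: real
    and D :: "'z measure"
    and G :: "'a \<Rightarrow> 'z \<Rightarrow> 'a"
    and M :: "'w measure"
    and \<xi> :: "nat \<Rightarrow> nat \<Rightarrow> 'w \<Rightarrow> 'z"
    and x\<^sub>0 :: 'a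
    and x :: "nat \<Rightarrow> 'w \<Rightarrow> 'a"
    and T B :: nat
  assumes f_not_MInf: "\<And>y. f y \<noteq> -\<infinity>"
    and dom: "open (fdom f)" "convex (fdom f)"
    and smooth: "l_smooth l f"
    and lower: "\<And>y. y \<in> fdom f \<Longrightarrow> ereal fstar \<le> f y"
    and r_finite: "bdd_above ((\<lambda>s. l (2 * s) / l s) ` {0..})"
    and r_eq: "r = doubling_ratio l"
    and D: "prob_space D"
    and G_measurable: "(\<lambda>(y, z). G y z) \<in> borel_measurable (restrict_space borel (fdom f) \<Otimes>\<^sub>M D)"
    and \<sigma>: "\<sigma> > 0"
    and unbiased: "\<And>y. y \<in> fdom f \<Longrightarrow> (\<integral>z. G y z \<partial>D) = grad f y"
    and light_tail: "\<And>y. y \<in> fdom f \<Longrightarrow>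
          (\<integral>\<^sup>+z. ennreal (exp ((norm (G y z - grad f y))\<^sup>2 / \<sigma>\<^sup>2)) \<partial>D) \<le> ennreal (exp 1)"
    and x0: "x\<^sub>0 \<in> fdom f"
    and \<Delta>_eq: "\<Delta> = real_of_ereal (f x\<^sub>0) - fstar"
    and \<epsilon>: "\<epsilon> > 0"
    and \<delta>: "0 < \<delta>" "\<delta> < 1"
    and T_pos: "T > 0"
    and B_eq: "B = max (nat \<lceil>32 * (1 + sqrt (3 * ln (real T / \<delta>)))\<^sup>2 * \<sigma>\<^sup>2 / \<epsilon>\<rceil>) 1"
    and M: "prob_space M"
    and indep: "prob_space.indep_vars M (\<lambda>_. D) (\<lambda>(k, j). \<xi> k j) (UNIV \<times> {1..B})"
    and copies: "\<And>k j. j \<in> {1..B} \<Longrightarrow> distr M D (\<xi> k j) = D"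
    and x_eq: "\<And>k \<omega>. x k \<omega> = sgd_point l G B x\<^sub>0 (\<lambda>k j. \<xi> k j \<omega>) k"
    and T_req: "AE \<omega> in M. (\<forall>k<T. x k \<omega> \<in> fdom f) \<longrightarrow>
          (MIN k\<in>{..<T}. (3 / 2 * norm (grad f (x k \<omega>)))\<^sup>2 / l (3 * norm (grad f (x k \<omega>))))
            \<le> r * (45 * \<Delta> / real T) \<longrightarrow>
          (MIN k\<in>{..<T}. (norm (grad f (x k \<omega>)))\<^sup>2) \<le> \<epsilon>"
  shows "measure M {\<omega> \<in> space M.
            \<exists>k<T. (\<forall>i\<le>k. x i \<omega> \<in> fdom f) \<and> stationary f \<epsilon> (x k \<omega>)} \<ge> 1 - \<delta> \<and>
         (\<forall>\<omega>\<in>space M. length (sgd_computed l G B x\<^sub>0 (\<lambda>k j. \<xi> k j \<omega>) T) = B * T)"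
proof -
  interpret M: prob_space M by fact
  interpret light_tailed_oracle f l D G \<sigma>
    by (intro light_tailed_oracle.intro generalized_smooth.intro light_tailed_oracle_axioms.intro) fact+
  define b where "b = sqrt (3 * ln (real T / \<delta>))"
  have "1 \<le> real T / \<delta>" using T_pos \<delta> by (simp add: field_simps)
  then have b: "0 \<le> b" and b2: "b\<^sup>2 = 3 * ln (real T / \<delta>)" by (simp_all add: b_def)
  \<comment> \<open>this is what fixes the constant 3 under the square root in the batch size\<close>
  have exp_b: "exp (- b\<^sup>2 / 3) = \<delta> / real T"
    using T_pos \<delta> by (simp add: b2 exp_minus)
  have B: "B \<ge> 1" "32 * (1 + b)\<^sup>2 * \<sigma>\<^sup>2 / \<epsilon> \<le> real B"
    unfolding B_eq b_def by (auto simp: of_nat_max intro!: max.coboundedI1) linarith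
  define Y where "Y k \<omega> = sgd_point l G' B x\<^sub>0 (\<lambda>i j. \<xi> i j \<omega>) k" for k \<omega>
  define bad where "bad k = {\<omega> \<in> space M. Y k \<omega> \<in> fdom f \<and>
      sqrt \<epsilon> / 4 \<le> norm (batch_mean G B (Y k \<omega>) (\<lambda>j. \<xi> k j \<omega>) - grad f (Y k \<omega>))}" for k
  note bad_k = bad_batch_prob[OF M indep copies B(1) b B(2) \<epsilon>, of x\<^sub>0, folded Y_def, folded bad_def, unfolded exp_b]
  have bad_prob: "measure M (\<Union>k<T. bad k) \<le> \<delta>"
  proof -
    have "measure M (\<Union>k<T. bad k) \<le> (\<Sum>k<T. measure M (bad k))"
      using bad_k(1) by (intro M.finite_measure_subadditive_finite) auto
    also have "\<dots> \<le> (\<Sum>k<T. \<delta> / real T)" by (intro sum_mono bad_k(2))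
    also have "\<dots> = \<delta>" using T_pos by simp
    finally show ?thesis .
  qed

  let ?goal = "{\<omega> \<in> space M. \<exists>k<T. (\<forall>i\<le>k. x i \<omega> \<in> fdom f) \<and> stationary f \<epsilon> (x k \<omega>)}"
  have Y_in_iff: "Y k \<omega> \<in> fdom f \<longleftrightarrow> (\<forall>i\<le>k. x i \<omega> \<in> fdom f)" for k \<omega>
    unfolding Y_def x_eq by (rule sgd_point_stopped_in_iff)
  have Y_eq: "Y k \<omega> = x k \<omega>" if "\<And>i. i < k \<Longrightarrow> x i \<omega> \<in> fdom f" for k \<omega>
    using that unfolding Y_def x_eq by (rule sgd_point_stopped_eq)
  have Y_meas[measurable]: "Y k \<in> borel_measurable M" for k
    unfolding Y_def[abs_def]
    using indep
    by (intro measurable_sgd_point[OF measurable_G' borel_measurable_step_size])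
      (auto simp: M.indep_vars_def)
  \<comment> \<open>the original iterates need not be measurable, but the event can be read off the frozen ones\<close>
  have goal_eq: "?goal = {\<omega> \<in> space M. \<exists>k\<in>{..<T}. Y k \<omega> \<in> fdom f \<and> (norm (grad0 (Y k \<omega>)))\<^sup>2 \<le> \<epsilon>}"
    by (auto simp: Y_in_iff Y_eq stationary_def grad0_def)
  have goal_sets: "?goal \<in> sets M" unfolding goal_eq by measurable

  have "AE \<omega> in M. \<omega> \<in> space M - (\<Union>k<T. bad k) \<longrightarrow> \<omega> \<in> ?goal"
    using T_req
  proof eventually_elim
    case (elim \<omega>)
    show ?case
    proof (rule impI, rule ccontr)
      assume \<omega>: "\<omega> \<in> space M - (\<Union>k<T. bad k)" and not_goal: "\<omega> \<notin> ?goal"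
      have large: "\<epsilon> < (norm (grad f (x k \<omega>)))\<^sup>2" if "k < T" "\<forall>i\<le>k. x i \<omega> \<in> fdom f" for k
        using not_goal \<omega> that by (auto simp: stationary_def not_le)
      have step: "x (Suc k) \<omega> \<in> fdom f \<and>
          F (x (Suc k) \<omega>) \<le> F (x k \<omega>) - (norm (grad f (x k \<omega>)))\<^sup>2 / (20 * doubling_ratio l * l (3 * norm (grad f (x k \<omega>))))"
        if k: "k < T" and inside: "\<forall>i\<le>k. x i \<omega> \<in> fdom f" for k
      proof -
        define g where "g = batch_mean G B (x k \<omega>) (\<lambda>j. \<xi> k j \<omega>)"
        have "Y k \<omega> = x k \<omega>" using inside by (intro Y_eq) auto
        moreover have "\<omega> \<in> space M" "\<omega> \<notin> bad k" using \<omega> k by auto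
        ultimately have "norm (g - grad f (x k \<omega>)) < sqrt \<epsilon> / 4"
          using inside by (simp add: bad_def g_def not_le)
        moreover have "sqrt \<epsilon> < norm (grad f (x k \<omega>))"
          using real_sqrt_less_mono[OF large[OF that]] by simp
        ultimately have "grad f (x k \<omega>) \<noteq> 0" "norm (g - grad f (x k \<omega>)) \<le> norm (grad f (x k \<omega>)) / 4"
          using \<epsilon> by auto
        moreover have "x (Suc k) \<omega> = x k \<omega> - step_size l g *\<^sub>R g"
          by (simp add: x_eq sgd_point_Suc g_def)
        ultimately show ?thesis
          using descent_step[of "x k \<omega>" g] inside by simp
      qed
      have inside: "\<forall>i\<le>k. x i \<omega> \<in> fdom f" if "k \<le> T" for k
        using that
      proof (induction k)
        case 0
        then show ?case using x0 by (simp add: x_eq)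
      next
        case (Suc k)
        then show ?case using step[of k] by (auto simp: le_Suc_eq)
      qed
      have low: "fstar \<le> F (x T \<omega>)"
        using lower[of "x T \<omega>"] inside[of T] f_eq_ereal_F[of "x T \<omega>"] by (metis ereal_less_eq(3) order_refl)
      have dec: "F (x (Suc k) \<omega>) \<le> F (x k \<omega>) -
          (norm (grad f (x k \<omega>)))\<^sup>2 / (20 * doubling_ratio l * l (3 * norm (grad f (x k \<omega>))))"
        if "k < T" for k
        using step[OF that] inside[of k] that by simp
      have "\<Delta> = F (x 0 \<omega>) - fstar" by (simp add: \<Delta>_eq x_eq)
      then have "(MIN k\<in>{..<T}. (3 / 2 * norm (grad f (x k \<omega>)))\<^sup>2 / l (3 * norm (grad f (x k \<omega>))))
          \<le> r * (45 * \<Delta> / real T)"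
        using min_gradient_bound[of T fstar "\<lambda>k. x k \<omega>", OF T_pos low dec] by (simp only: r_eq)
      moreover have "\<forall>k<T. x k \<omega> \<in> fdom f" using inside[of T] by simp
      ultimately have "(MIN k\<in>{..<T}. (norm (grad f (x k \<omega>)))\<^sup>2) \<le> \<epsilon>" using elim by blast
      moreover have "(MIN k\<in>{..<T}. (norm (grad f (x k \<omega>)))\<^sup>2) \<in> (\<lambda>k. (norm (grad f (x k \<omega>)))\<^sup>2) ` {..<T}"
        using T_pos by (intro Min_in) auto
      ultimately obtain k where "k < T" "(norm (grad f (x k \<omega>)))\<^sup>2 \<le> \<epsilon>" by auto
      with large[of k] inside[of k] show False by simp
    qed
  qed
  then have "measure M (space M - (\<Union>k<T. bad k)) \<le> measure M ?goal"
    by (rule M.finite_measure_mono_AE[OF _ goal_sets])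
  moreover have "measure M (space M - (\<Union>k<T. bad k)) = 1 - measure M (\<Union>k<T. bad k)"
    using bad_k(1) by (intro M.prob_compl) auto
  ultimately have "measure M ?goal \<ge> 1 - \<delta>" using bad_prob by linarith
  then show ?thesis by (simp add: length_sgd_computed)
qed

end
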